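(* Let $c_1,c_2>0$. On the Siegel--Jacobi upper half-plane $\mathcal{X}^J_1$ consider the balanced metric $$\mathrm{d}s^2_{\mathcal{X}^J_1}(\tau,z)=-c_1\frac{\mathrm{d}\tau\,\mathrm{d}\bar\tau}{(\tau-\bar\tau)^2}+\frac{2\mathrm{i}c_2}{\tau-\bar\tau}(\mathrm{d}z-p\,\mathrm{d}\tau)(\mathrm{d}\bar z-p\,\mathrm{d}\bar\tau),\qquad p=\frac{z-\bar z}{\tau-\bar\tau}.$$ (1) In the variables $(x,y,p,q)$ it is $$\mathrm{d}s^2_{\mathcal{X}^J_1}=c_1\frac{\mathrm{d}x^2+\mathrm{d}y^2}{4y^2}+\frac{c_2}{y}\big[(x^2+y^2)\mathrm{d}p^2+\mathrm{d}q^2+2x\,\mathrm{d}p\,\mathrm{d}q\big]$$ $$=c_1\frac{\mathrm{d}x^2+\mathrm{d}y^2}{4y^2}+c_2\frac{x^2+y^2}{y}\Big[\Big(\mathrm{d}p+\frac{x}{x^2+y^2}\mathrm{d}q\Big)^2+\Big(\frac{y\,\mathrm{d}q}{x^2+y^2}\Big)^2\Big],$$ and in the variables $(x,y,\xi,\eta)$ it is $$\mathrm{d}s^2_{\mathcal{X}^J_1}=c_1\frac{\mathrm{d}x^2+\mathrm{d}y^2}{4y^2}+\frac{c_2}{y}\Big[\mathrm{d}\xi^2+\mathrm{d}\eta^2+\Big(\frac{\eta}{y}\Big)^2(\mathrm{d}x^2+\mathrm{d}y^2)-2\frac{\eta}{y}(\mathrm{d}x\,\mathrm{d}\xi+\mathrm{d}y\,\mathrm{d}\eta)\Big].$$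 (2) The metric is left-invariant under the action of the reduced Jacobi group $G^J(\mathbb{R})_0$ on $\mathcal{X}^J_1$, and it is Kähler. (3) Put $\alpha=\frac{c_1}4$, $\gamma=c_2$. The matrix of the metric in the variables $(x,y,p,q)$ has nonzero entries (up to symmetry) $g_{xx}=g_{yy}=\frac{\alpha}{y^2}$, $g_{pp}=\gamma\frac{x^2+y^2}{y}$, $g_{qq}=\frac\gamma y$, $g_{pq}=\gamma\frac xy$, and $$\mathrm{d}s^2_{\mathcal{X}^J_1}=\lambda_1^2+\lambda_2^2+\lambda_4^2+\lambda_5^2.$$ The vector fields $$L^1_0=\tfrac{y}{\sqrt\alpha}(\cos2\theta\,\partial_x+\sin2\theta\,\partial_y),\quad L^2_0=\tfrac{y}{\sqrt\alpha}(-\sin2\theta\,\partial_x+\cos2\theta\,\partial_y),$$ $$L^4_0=\tfrac1{\sqrt{\gamma y}}\big(\cos\theta\,\partial_p-(x\cos\theta+y\sin\theta)\partial_q\big),\quad L^5_0=\tfrac1{\sqrt{\gamma y}}\big(\sin\theta\,\partial_p+(y\cos\theta-x\sin\theta)\partial_q\big)$$ are dual to the one-forms, $\langle\lambda_i\,|\,L^j_0\rangle=\delta_{ij}$ for $i,j\in\{1,2,4,5\}$, and are orthonormal with respect to the metric. (4) The fundamental vector fields of the action, in the variables $(x,y,p,q)$, $$F^*=\partial_x-p\partial_q,\quad G^*=(y^2-x^2)\partial_x-2xy\,\partial_y-q\partial_p,\quad H^*=2(x\partial_x+y\partial_y)-p\partial_p+q\partial_q,$$ $$P^*=\partial_p,\quad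 Q^*=\partial_q,\quad R^*=0,$$ are the solutions of the equations of the Killing vector fields $X=X^1\partial_x+X^2\partial_y+X^3\partial_p+X^4\partial_q$ on $\mathcal{X}^J_1$ corresponding to the invariant metric in the variables $(x,y,p,q)$, namely $$-X^2+y\partial_xX^1=0,\qquad \partial_xX^2+\partial_yX^1=0,$$ $$c_2\big[(x^2+y^2)\partial_xX^3+x\partial_xX^4\big]+\tfrac{c_1}{4y}\partial_pX^1=0,\qquad \tfrac{c_1}{4y}\partial_qX^1+c_2\big(x\partial_xX^3+\partial_xX^4\big)=0,$$ $$-X^2+y\partial_yX^2=0,\qquad c_2\big[(x^2+y^2)\partial_yX^3+x\partial_yX^4\big]+\tfrac{c_1}{4y}\partial_pX^2=0,$$ $$c_2\big[x\partial_yX^3+\partial_yX^4\big]+\tfrac{c_1}{4y}\partial_qX^2=0,$$ $$2xyX^1+(-x^2+y^2)X^2+2y(x^2+y^2)\partial_pX^3+2xy\,\partial_pX^4=0,$$ $$yX^1-xX^2+xy\,\partial_pX^3+y\,\partial_pX^4+y(x^2+y^2)\partial_qX^3+xy\,\partial_qX^4=0,$$ $$-X^2+2xy\,\partial_qX^3+2y\,\partial_qX^4=0.$$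
   Context: $\mathcal{X}^J_1$ is the set of $(\tau,z)$ with $\tau=x+\mathrm{i}y$, $y>0$, and $z=\xi+\mathrm{i}\eta=p\tau+q\in\mathbb{C}$, $p,q\in\mathbb{R}$ (so $\xi=px+q$, $\eta=py$), a complex manifold with holomorphic coordinates $(\tau,z)$. $G^J(\mathbb{R})_0$ is the group of pairs $(M,X)$, $M=\begin{pmatrix}a&b\\c&d\end{pmatrix}\in\mathrm{SL}(2,\mathbb{R})$, $X=(\lambda,\mu)\in\mathbb{R}^2$, with product $(M,X)(M',X')=(MM',XM'+X')$, acting by $(M,X)\cdot(\tau,z)=\big(\frac{a\tau+b}{c\tau+d},\frac{z+\lambda\tau+\mu}{c\tau+d}\big)$; in the variables $(p,q)$ the action sends $(p',q')$ to $(p,q)+(p',q')M^{-1}$, where $(p,q)=XM^{-1}$. It is the quotient, by the subgroup generated by $R$, of the real Jacobi group, whose Lie algebra has generators $F,G,H$ (of $\mathfrak{sl}(2,\mathbb{R})$: $F=\begin{pmatrix}0&1\\0&0\end{pmatrix}$, $G=\begin{pmatrix}0&0\\1&0\end{pmatrix}$, $H=\begin{pmatrix}1&0\\0&-1\end{pmatrix}$), $P,Q$ (the directions $\lambda$, $\mu$ of $X$) and $R$ (central). The fundamental vector field $V^*$ of a Lie algebra element $V$ is $\frac{\mathrm{d}}{\mathrm{d}t}\big(\exp(tV)\cdot m\big)\big|_{t=0}$ at the point $m$. The one-forms, in which $\theta$ is the Iwasawa angle and enters as a parameter, are: $\lambda_1=\frac{\sqrt\alpha}{y}(\cos2\theta\,\mathrm{d}x+\sin2\theta\,\mathrm{d}y)$,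 $\lambda_2=\frac{\sqrt\alpha}{y}(-\sin2\theta\,\mathrm{d}x+\cos2\theta\,\mathrm{d}y)$, $\lambda_4=\sqrt\gamma\big[-y^{-1/2}\sin\theta\,\mathrm{d}q+(y^{1/2}\cos\theta-xy^{-1/2}\sin\theta)\mathrm{d}p\big]$, $\lambda_5=\sqrt\gamma\big[y^{-1/2}\cos\theta\,\mathrm{d}q+(y^{1/2}\sin\theta+xy^{-1/2}\cos\theta)\mathrm{d}p\big]$. They come from left-invariant one-forms on the real Jacobi group. "Balanced" refers to the metric whose Kähler potential is the logarithm of the scalar product of coherent state vectors. A vector field is Killing for $g$ if the Lie derivative of $g$ along it vanishes. *)

theory Defs
  imports "HOL-Analysis.Analysis" "HOL-Algebra.Group"
begin

section \<open>Tensor calculus on open subsets of normed spaces\<close>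

text \<open>Tangent spaces are identified with the ambient vector space. A vector field is a map
  \<open>'a \<Rightarrow> 'a\<close>, a covariant 2-tensor field a map \<open>'a \<Rightarrow> 'a \<Rightarrow> 'a \<Rightarrow> real\<close>, whose first argument is
  the base point. On an open set \<open>S\<close>, only the values on \<open>S\<close> matter.\<close>

primrec ck_on :: "nat \<Rightarrow> 'a::real_normed_vector set \<Rightarrow> ('a \<Rightarrow> 'b::real_normed_vector) \<Rightarrow> bool" where
  "ck_on 0 S f \<longleftrightarrow> continuous_on S f"
| "ck_on (Suc k) S f \<longleftrightarrow>
     (\<forall>m\<in>S. f differentiable (at m)) \<and> (\<forall>v. ck_on k S (\<lambda>m. frechet_derivative f (at m) v))"

definition smooth_on :: "'a::real_normed_vector set \<Rightarrow> ('a \<Rightarrow> 'b::real_normed_vector) \<Rightarrow> bool" where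
  "smooth_on S f \<longleftrightarrow> (\<forall>k. ck_on k S f)"

definition riemannian_on ::
    "'a::real_normed_vector set \<Rightarrow> ('a \<Rightarrow> 'a \<Rightarrow> 'a \<Rightarrow> real) \<Rightarrow> bool" where
  "riemannian_on S g \<longleftrightarrow>
     (\<forall>m\<in>S. bilinear (g m) \<and> (\<forall>v w. g m v w = g m w v) \<and> (\<forall>v. v \<noteq> 0 \<longrightarrow> g m v v > 0)) \<and>
     (\<forall>v w. smooth_on S (\<lambda>m. g m v w))"

definition pullback ::
    "('a::real_normed_vector \<Rightarrow> 'b::real_normed_vector) \<Rightarrow> ('b \<Rightarrow> 'b \<Rightarrow> 'b \<Rightarrow> real) \<Rightarrow>
     'a \<Rightarrow> 'a \<Rightarrow> 'a \<Rightarrow> real" where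
  "pullback f g m v w =
     g (f m) (frechet_derivative f (at m) v) (frechet_derivative f (at m) w)"

definition preserves_metric_on ::
    "'a::real_normed_vector set \<Rightarrow> ('a \<Rightarrow> 'a \<Rightarrow> 'a \<Rightarrow> real) \<Rightarrow> ('a \<Rightarrow> 'a) \<Rightarrow> bool" where
  "preserves_metric_on S g f \<longleftrightarrow>
     (\<forall>m\<in>S. f m \<in> S \<and> f differentiable (at m) \<and> (\<forall>v w. pullback f g m v w = g m v w))"

text \<open>The Lie derivative \<open>(L\<^sub>X g)(v, w) = X(g(v, w)) - g([X, v], w) - g(v, [X, w])\<close>, evaluated on
  constant vector fields \<open>v\<close>, \<open>w\<close>, for which \<open>[X, v]\<close> is minus the derivative of \<open>X\<close> along \<open>v\<close>.\<close>

definition lie_derivative ::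
    "('a::real_normed_vector \<Rightarrow> 'a) \<Rightarrow> ('a \<Rightarrow> 'a \<Rightarrow> 'a \<Rightarrow> real) \<Rightarrow> 'a \<Rightarrow> 'a \<Rightarrow> 'a \<Rightarrow> real" where
  "lie_derivative X g m v w =
     frechet_derivative (\<lambda>m. g m v w) (at m) (X m) +
     g m (frechet_derivative X (at m) v) w +
     g m v (frechet_derivative X (at m) w)"

definition killing_on ::
    "'a::real_normed_vector set \<Rightarrow> ('a \<Rightarrow> 'a \<Rightarrow> 'a \<Rightarrow> real) \<Rightarrow> ('a \<Rightarrow> 'a) \<Rightarrow> bool" where
  "killing_on S g X \<longleftrightarrow> smooth_on S X \<and> (\<forall>m\<in>S. \<forall>v w. lie_derivative X g m v w = 0)"

text \<open>The exterior derivative of a 2-form, evaluated on constant vector fields \<open>u\<close>, \<open>v\<close>, \<open>w\<close>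
  (up to the normalisation factor, irrelevant for closedness).\<close>

definition closed_2form_on ::
    "'a::real_normed_vector set \<Rightarrow> ('a \<Rightarrow> 'a \<Rightarrow> 'a \<Rightarrow> real) \<Rightarrow> bool" where
  "closed_2form_on S \<omega> \<longleftrightarrow> (\<forall>m\<in>S. \<forall>u v w.
     frechet_derivative (\<lambda>m. \<omega> m v w) (at m) u +
     frechet_derivative (\<lambda>m. \<omega> m w u) (at m) v +
     frechet_derivative (\<lambda>m. \<omega> m u v) (at m) w = 0)"

definition cpx_structure :: "complex \<times> complex \<Rightarrow> complex \<times> complex" where
  "cpx_structure v = (\<i> * fst v, \<i> * snd v)"

definition kaehler_on ::
    "(complex \<times> complex) set \<Rightarrow>
     (complex \<times> complex \<Rightarrow> complex \<times> complex \<Rightarrow> complex \<times> complex \<Rightarrow> real) \<Rightarrow> bool" where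
  "kaehler_on S g \<longleftrightarrow>
     riemannian_on S g \<and>
     (\<forall>m\<in>S. \<forall>v w. g m (cpx_structure v) (cpx_structure w) = g m v w) \<and>
     closed_2form_on S (\<lambda>m v w. g m (cpx_structure v) w)"

section \<open>The Siegel--Jacobi upper half-plane and its balanced metric\<close>

definition siegel_jacobi :: "(complex \<times> complex) set" where
  "siegel_jacobi = {(\<tau>, z). Im \<tau> > 0}"

text \<open>The line element as a quadratic form in the tangent vector \<open>(d\<tau>, dz)\<close>. Its values are real,
  although the expression is a complex one.\<close>

definition balanced_ds2 :: "real \<Rightarrow> real \<Rightarrow> complex \<times> complex \<Rightarrow> complex \<times> complex \<Rightarrow> complex" where
  "balanced_ds2 c1 c2 = (\<lambda>(\<tau>, z) (d\<tau>, dz).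
     let p = (z - cnj z) / (\<tau> - cnj \<tau>) in
       - complex_of_real c1 * (d\<tau> * cnj d\<tau>) / (\<tau> - cnj \<tau>)\<^sup>2 +
       2 * \<i> * complex_of_real c2 / (\<tau> - cnj \<tau>) * (dz - p * d\<tau>) * (cnj dz - p * cnj d\<tau>))"

text \<open>The metric tensor is the polarisation of the line element.\<close>

definition balanced_metric ::
    "real \<Rightarrow> real \<Rightarrow> complex \<times> complex \<Rightarrow> complex \<times> complex \<Rightarrow> complex \<times> complex \<Rightarrow> real" where
  "balanced_metric c1 c2 m v w =
     Re (balanced_ds2 c1 c2 m (v + w) - balanced_ds2 c1 c2 m (v - w)) / 4"

subsection \<open>The real coordinates\<close>

type_synonym real4 = "real \<times> real \<times> real \<times> real"

text \<open>The range of both coordinate systems \<open>(x, y, p, q)\<close> and \<open>(x, y, \<xi>, \<eta>)\<close>.\<close>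

definition coord_domain :: "real4 set" where
  "coord_domain = {(x, y, p, q). y > 0}"

definition from_xypq :: "real4 \<Rightarrow> complex \<times> complex" where
  "from_xypq = (\<lambda>(x, y, p, q).
     (Complex x y, complex_of_real p * Complex x y + complex_of_real q))"

definition to_xypq :: "complex \<times> complex \<Rightarrow> real4" where
  "to_xypq = (\<lambda>(\<tau>, z). (Re \<tau>, Im \<tau>, Im z / Im \<tau>, Re z - Im z / Im \<tau> * Re \<tau>))"

definition from_xyxieta :: "real4 \<Rightarrow> complex \<times> complex" where
  "from_xyxieta = (\<lambda>(x, y, \<xi>, \<eta>). (Complex x y, Complex \<xi> \<eta>))"

lemma to_from_xypq: "m \<in> coord_domain \<Longrightarrow> to_xypq (from_xypq m) = m"
  by (auto simp: coord_domain_def to_xypq_def from_xypq_def)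

lemma from_to_xypq: "m \<in> siegel_jacobi \<Longrightarrow> from_xypq (to_xypq m) = m"
  by (auto simp: siegel_jacobi_def to_xypq_def from_xypq_def complex_eq_iff)

lemma bij_from_xypq: "bij_betw from_xypq coord_domain siegel_jacobi"
  by (rule bij_betw_byWitness[where f' = to_xypq])
    (use to_from_xypq from_to_xypq in
      \<open>auto simp: coord_domain_def siegel_jacobi_def to_xypq_def from_xypq_def\<close>)

lemma bij_from_xyxieta: "bij_betw from_xyxieta coord_domain siegel_jacobi"
  by (rule bij_betw_byWitness[where f' = "\<lambda>(\<tau>, z). (Re \<tau>, Im \<tau>, Re z, Im z)"])
    (auto simp: coord_domain_def siegel_jacobi_def from_xyxieta_def)

text \<open>The line element and the metric in real coordinates; the last arguments are tangent
  vectors with components \<open>(dx, dy, dp, dq)\<close>, respectively \<open>(dx, dy, d\<xi>, d\<eta>)\<close>.\<close>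

definition ds2_xypq :: "real \<Rightarrow> real \<Rightarrow> real4 \<Rightarrow> real4 \<Rightarrow> complex" where
  "ds2_xypq c1 c2 m v = balanced_ds2 c1 c2 (from_xypq m) (frechet_derivative from_xypq (at m) v)"

definition ds2_xyxieta :: "real \<Rightarrow> real \<Rightarrow> real4 \<Rightarrow> real4 \<Rightarrow> complex" where
  "ds2_xyxieta c1 c2 m v =
     balanced_ds2 c1 c2 (from_xyxieta m) (frechet_derivative from_xyxieta (at m) v)"

definition metric_xypq :: "real \<Rightarrow> real \<Rightarrow> real4 \<Rightarrow> real4 \<Rightarrow> real4 \<Rightarrow> real" where
  "metric_xypq c1 c2 = pullback from_xypq (balanced_metric c1 c2)"

definition coord_basis :: "real4 ^ 4" where
  "coord_basis = vector [(1, 0, 0, 0), (0, 1, 0, 0), (0, 0, 1, 0), (0, 0, 0, 1)]"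

definition metric_matrix :: "(real4 \<Rightarrow> real4 \<Rightarrow> real4 \<Rightarrow> real) \<Rightarrow> real4 \<Rightarrow> real ^ 4 ^ 4" where
  "metric_matrix g m = (\<chi> i j. g m (coord_basis $ i) (coord_basis $ j))"

subsection \<open>The invariant one-forms and the orthonormal frame\<close>

text \<open>The indices are 1, 2, 4, 5.\<close>

definition inv_form :: "real \<Rightarrow> real \<Rightarrow> real \<Rightarrow> nat \<Rightarrow> real4 \<Rightarrow> real4 \<Rightarrow> real" where
  "inv_form \<alpha> \<gamma> \<theta> i = (\<lambda>(x, y, p, q) (dx, dy, dp, dq).
     if i = 1 then sqrt \<alpha> / y * (cos (2 * \<theta>) * dx + sin (2 * \<theta>) * dy)
     else if i = 2 then sqrt \<alpha> / y * (- sin (2 * \<theta>) * dx + cos (2 * \<theta>) * dy)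
     else if i = 4 then
       sqrt \<gamma> * (- (1 / sqrt y) * sin \<theta> * dq + (sqrt y * cos \<theta> - x * (1 / sqrt y) * sin \<theta>) * dp)
     else if i = 5 then
       sqrt \<gamma> * ((1 / sqrt y) * cos \<theta> * dq + (sqrt y * sin \<theta> + x * (1 / sqrt y) * cos \<theta>) * dp)
     else 0)"

definition inv_frame :: "real \<Rightarrow> real \<Rightarrow> real \<Rightarrow> nat \<Rightarrow> real4 \<Rightarrow> real4" where
  "inv_frame \<alpha> \<gamma> \<theta> i = (\<lambda>(x, y, p, q).
     if i = 1 then (y / sqrt \<alpha>) *\<^sub>R (cos (2 * \<theta>), sin (2 * \<theta>), 0, 0)
     else if i = 2 then (y / sqrt \<alpha>) *\<^sub>R (- sin (2 * \<theta>), cos (2 * \<theta>), 0, 0)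
     else if i = 4 then (1 / sqrt (\<gamma> * y)) *\<^sub>R (0, 0, cos \<theta>, - (x * cos \<theta> + y * sin \<theta>))
     else if i = 5 then (1 / sqrt (\<gamma> * y)) *\<^sub>R (0, 0, sin \<theta>, y * cos \<theta> - x * sin \<theta>)
     else 0)"

section \<open>The Jacobi groups and their action\<close>

definition reduced_jacobi :: "((real ^ 2 ^ 2) \<times> (real ^ 2)) monoid" where
  "reduced_jacobi =
     \<lparr>carrier = {(M, X). det M = 1},
      mult = (\<lambda>(M, X) (M', X'). (M ** M', X v* M' + X')),
      one = (mat 1, 0)\<rparr>"

definition jacobi_act :: "(real ^ 2 ^ 2) \<times> (real ^ 2) \<Rightarrow> complex \<times> complex \<Rightarrow> complex \<times> complex" where
  "jacobi_act = (\<lambda>(M, X) (\<tau>, z).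
     let a = complex_of_real (M $ 1 $ 1); b = complex_of_real (M $ 1 $ 2);
         c = complex_of_real (M $ 2 $ 1); d = complex_of_real (M $ 2 $ 2);
         l = complex_of_real (X $ 1); \<mu> = complex_of_real (X $ 2)
     in ((a * \<tau> + b) / (c * \<tau> + d), (z + l * \<tau> + \<mu>) / (c * \<tau> + d)))"

text \<open>The real Jacobi group is the semidirect product of \<open>SL(2, \<real>)\<close> with the Heisenberg group: a
  central extension of the reduced group, with cocycle the determinant of the matrix with rows
  \<open>X M'\<close> and \<open>X'\<close>. It acts through the projection that forgets the central coordinate \<open>\<kappa>\<close>.\<close>

type_synonym jacobi_space = "(real ^ 2 ^ 2) \<times> (real ^ 2) \<times> real"

definition real_jacobi :: "jacobi_space monoid" where
  "real_jacobi =
     \<lparr>carrier = {(M, X, \<kappa>). det M = 1},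
      mult = (\<lambda>(M, X, \<kappa>) (M', X', \<kappa>').
        (M ** M', X v* M' + X', \<kappa> + \<kappa>' + det (vector [X v* M', X'] :: real ^ 2 ^ 2))),
      one = (mat 1, 0, 0)\<rparr>"

definition jacobi_proj :: "jacobi_space \<Rightarrow> (real ^ 2 ^ 2) \<times> (real ^ 2)" where
  "jacobi_proj = (\<lambda>(M, X, \<kappa>). (M, X))"

text \<open>Elements of the Lie algebra are the tangent vectors at the identity, in the ambient
  space of the group. The exponential is the value at 1 of the one-parameter subgroup with the
  given initial velocity.\<close>

definition one_param_subgroup :: "jacobi_space \<Rightarrow> (real \<Rightarrow> jacobi_space) \<Rightarrow> bool" where
  "one_param_subgroup V \<phi> \<longleftrightarrow>
     (\<forall>t. \<phi> t \<in> carrier real_jacobi) \<and>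
     (\<forall>s t. \<phi> (s + t) = \<phi> s \<otimes>\<^bsub>real_jacobi\<^esub> \<phi> t) \<and>
     (\<phi> has_vector_derivative V) (at 0)"

definition jacobi_exp :: "jacobi_space \<Rightarrow> jacobi_space" where
  "jacobi_exp V = (THE \<phi>. one_param_subgroup V \<phi>) 1"

definition gen_F :: jacobi_space where
  "gen_F = (vector [vector [0, 1], vector [0, 0]], 0, 0)"

definition gen_G :: jacobi_space where
  "gen_G = (vector [vector [0, 0], vector [1, 0]], 0, 0)"

definition gen_H :: jacobi_space where
  "gen_H = (vector [vector [1, 0], vector [0, -1]], 0, 0)"

definition gen_P :: jacobi_space where
  "gen_P = (0, vector [1, 0], 0)"

definition gen_Q :: jacobi_space where
  "gen_Q = (0, vector [0, 1], 0)"

definition gen_R :: jacobi_space where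
  "gen_R = (0, 0, 1)"

definition fundamental_field :: "jacobi_space \<Rightarrow> complex \<times> complex \<Rightarrow> complex \<times> complex" where
  "fundamental_field V m =
     vector_derivative (\<lambda>t. jacobi_act (jacobi_proj (jacobi_exp (t *\<^sub>R V))) m) (at 0)"

text \<open>The components of the fundamental vector field with respect to
  \<open>\<partial>\<^sub>x, \<partial>\<^sub>y, \<partial>\<^sub>p, \<partial>\<^sub>q\<close>.\<close>

definition fundamental_xypq :: "jacobi_space \<Rightarrow> real4 \<Rightarrow> real4" where
  "fundamental_xypq V m =
     frechet_derivative to_xypq (at (from_xypq m)) (fundamental_field V (from_xypq m))"

section \<open>The equations of the Killing vector fields\<close>

definition pdx :: "(real4 \<Rightarrow> real) \<Rightarrow> real4 \<Rightarrow> real" where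
  "pdx f m = frechet_derivative f (at m) (1, 0, 0, 0)"

definition pdy :: "(real4 \<Rightarrow> real) \<Rightarrow> real4 \<Rightarrow> real" where
  "pdy f m = frechet_derivative f (at m) (0, 1, 0, 0)"

definition pdp :: "(real4 \<Rightarrow> real) \<Rightarrow> real4 \<Rightarrow> real" where
  "pdp f m = frechet_derivative f (at m) (0, 0, 1, 0)"

definition pdq :: "(real4 \<Rightarrow> real) \<Rightarrow> real4 \<Rightarrow> real" where
  "pdq f m = frechet_derivative f (at m) (0, 0, 0, 1)"

definition killing_equations :: "real \<Rightarrow> real \<Rightarrow> (real4 \<Rightarrow> real4) \<Rightarrow> bool" where
  "killing_equations c1 c2 X \<longleftrightarrow>
     (let X1 = (\<lambda>m. fst (X m)); X2 = (\<lambda>m. fst (snd (X m)));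
          X3 = (\<lambda>m. fst (snd (snd (X m)))); X4 = (\<lambda>m. snd (snd (snd (X m))))
      in \<forall>x y p q. y > 0 \<longrightarrow> (let m = (x, y, p, q) in
        - X2 m + y * pdx X1 m = 0 \<and>
        pdx X2 m + pdy X1 m = 0 \<and>
        c2 * ((x\<^sup>2 + y\<^sup>2) * pdx X3 m + x * pdx X4 m) + c1 / (4 * y) * pdp X1 m = 0 \<and>
        c1 / (4 * y) * pdq X1 m + c2 * (x * pdx X3 m + pdx X4 m) = 0 \<and>
        - X2 m + y * pdy X2 m = 0 \<and>
        c2 * ((x\<^sup>2 + y\<^sup>2) * pdy X3 m + x * pdy X4 m) + c1 / (4 * y) * pdp X2 m = 0 \<and>
        c2 * (x * pdy X3 m + pdy X4 m) + c1 / (4 * y) * pdq X2 m = 0 \<and>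
        2 * x * y * X1 m + (- x\<^sup>2 + y\<^sup>2) * X2 m
          + 2 * y * (x\<^sup>2 + y\<^sup>2) * pdp X3 m + 2 * x * y * pdp X4 m = 0 \<and>
        y * X1 m - x * X2 m + x * y * pdp X3 m + y * pdp X4 m
          + y * (x\<^sup>2 + y\<^sup>2) * pdq X3 m + x * y * pdq X4 m = 0 \<and>
        - X2 m + 2 * x * y * pdq X3 m + 2 * y * pdq X4 m = 0))"

end

theory Submission
  imports Defs
begin

text \<open>
  Everything about the metric follows from one formula. With \<open>y = Im \<tau>\<close> and \<open>p = Im z / Im \<tau>\<close>, it is
  \<open>c\<^sub>1 / (4 y\<^sup>2) \<bar>d\<tau>\<bar>\<^sup>2 + c\<^sub>2 / y \<bar>dz - p d\<tau>\<bar>\<^sup>2\<close>, a hyperbolic metric on the base plus a flat metric on the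
  fibre (lemma \<open>balanced_metric_eq\<close>). Since \<open>z = p \<tau> + q\<close> gives \<open>dz - p d\<tau> = \<tau> dp + dq\<close>, the
  expressions in real coordinates and the orthonormal frame can be read off from it.
  It is invariant because an element with lower row \<open>(c, d)\<close> multiplies \<open>y\<close>, \<open>d\<tau>\<close> and \<open>dz - p d\<tau>\<close> by
  \<open>\<bar>j\<bar>\<^sup>-\<^sup>2\<close>, \<open>j\<^sup>-\<^sup>2\<close> and \<open>j\<^sup>-\<^sup>1\<close> respectively, where \<open>j = c \<tau> + d\<close>. Both summands are Hermitian, so only
  the closedness of the associated 2-form has to be computed for the Kaehler property.

  A one-parameter subgroup is determined by its initial velocity: for two of them with the same
  velocity, the curve \<open>\<phi>(t) \<psi>(-t)\<close> has derivative zero (lemma \<open>one_param_subgroup_unique\<close>). So the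
  exponentials of the generators are the evident matrices, and the fundamental vector fields are
  derivatives of explicit curves.

  The ten equations are the ten components of the Lie derivative of the metric, up to nonzero
  factors. They are solved as follows. The three of them that involve the base alone say that, for
  fixed \<open>(p, q)\<close>, the base part is a Killing field of the hyperbolic plane:
  \<open>X\<^sup>1 = B (x\<^sup>2 - y\<^sup>2) + A x + E\<close> and \<open>X\<^sup>2 = y (A + 2 B x)\<close>, where \<open>A\<close>, \<open>B\<close>, \<open>E\<close> are functions of
  \<open>(p, q)\<close> (lemma \<open>half_plane_killing_field\<close>). The four mixed equations then prescribe the
  \<open>x\<close>- and \<open>y\<close>-derivatives of \<open>X\<^sup>3\<close> and \<open>X\<^sup>4\<close>, and the symmetry of the second derivatives of \<open>X\<^sup>3\<close> forces
  \<open>B\<^sub>q = 0\<close>, \<open>B\<^sub>p = A\<^sub>q\<close>, \<open>A\<^sub>p = E\<^sub>q\<close>, \<open>E\<^sub>p = 0\<close> (lemma \<open>mixed_derivatives_force\<close>).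
  This determines \<open>X\<^sup>3\<close> and \<open>X\<^sup>4\<close> up to two functions \<open>M\<close>, \<open>N\<close> of \<open>(p, q)\<close>. Two of the equations in the fibre
  directions yield \<open>M\<^sub>p = - A / 2\<close>, \<open>M\<^sub>q = B\<close>, \<open>N\<^sub>p = - E\<close>, \<open>N\<^sub>q = A / 2\<close>; now the symmetry of the second
  derivatives of \<open>M\<close> and \<open>N\<close> makes \<open>A\<close>, \<open>B\<close>, \<open>E\<close> constant. Five constants remain, one for each of
  the generators \<open>F\<close>, \<open>G\<close>, \<open>H\<close>, \<open>P\<close>, \<open>Q\<close>.
\<close>

section \<open>Smooth functions and the symmetry of second derivatives\<close>

lemma ck_on_Suc_imp_ck_on: "ck_on (Suc k) S f \<Longrightarrow> ck_on k S f"
proof (induction k arbitrary: f)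
  case 0
  then show ?case
    by (auto intro!: continuous_at_imp_continuous_on differentiable_imp_continuous_within)
next
  case (Suc k)
  then show ?case by (metis ck_on.simps(2))
qed

lemma ck_on_cong:
  assumes "open S" and "\<And>m. m \<in> S \<Longrightarrow> f m = g m"
  shows "ck_on k S f \<longleftrightarrow> ck_on k S g"
  using assms(2)
proof (induction k arbitrary: f g)
  case 0
  then show ?case by (auto cong: continuous_on_cong)
next
  case (Suc k)
  have *: "(f has_derivative D) (at m) \<longleftrightarrow> (g has_derivative D) (at m)" if "m \<in> S" for m D
    using has_derivative_transform_within_open[OF _ \<open>open S\<close> that] Suc.prems by metis
  then have "frechet_derivative f (at m) = frechet_derivative g (at m)" if "m \<in> S" for m
    using that by (simp add: frechet_derivative_def)
  then have "ck_on k S (\<lambda>m. frechet_derivative f (at m) v) \<longleftrightarrow> ck_on k S (\<lambda>m. frechet_derivative g (at m) v)" for v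
    by (intro Suc.IH) simp
  then show ?case using * by (auto simp: differentiable_def)
qed

lemma ck_on_const: "ck_on k S (\<lambda>m. c)"
  by (induction k arbitrary: c) (auto simp: continuous_on_const)

lemma ck_on_bounded_linear: "bounded_linear L \<Longrightarrow> ck_on k S L"
proof (cases k)
  case 0
  then show "bounded_linear L \<Longrightarrow> ck_on k S L" by (simp add: linear_continuous_on)
next
  case (Suc n)
  assume L: "bounded_linear L"
  then have "frechet_derivative L (at m) = L" for m
    using frechet_derivative_at[OF bounded_linear_imp_has_derivative] by metis
  then show ?thesis using L Suc by (simp add: bounded_linear_imp_differentiable ck_on_const)
qed

text \<open>The definition of order \<open>k + 1\<close> speaks of \<open>frechet_derivative\<close>; this rule allows any known
  formula for the derivative instead, and drives the inductions below.\<close>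

lemma ck_on_SucI:
  assumes "open S" and D: "\<And>m. m \<in> S \<Longrightarrow> (f has_derivative D m) (at m)"
    and "\<And>v. ck_on k S (\<lambda>m. D m v)"
  shows "ck_on (Suc k) S f"
proof -
  have "frechet_derivative f (at m) = D m" if "m \<in> S" for m
    using frechet_derivative_at[OF D[OF that]] by simp
  then have "ck_on k S (\<lambda>m. frechet_derivative f (at m) v)" for v
    using assms(3)[of v] by (subst ck_on_cong[OF \<open>open S\<close>, where g = "\<lambda>m. D m v"]) auto
  then show ?thesis using D by (auto simp: differentiable_def)
qed

lemma ck_on_has_derivative:
  "ck_on (Suc k) S f \<Longrightarrow> m \<in> S \<Longrightarrow> (f has_derivative frechet_derivative f (at m)) (at m)"
  by (simp add: frechet_derivative_works)

lemma ck_on_linear_compose: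
  assumes "open S" and L: "bounded_linear L" and "ck_on k S f"
  shows "ck_on k S (\<lambda>m. L (f m))"
  using assms(3)
proof (induction k arbitrary: f)
  case 0
  then show ?case 
    by (auto intro: bounded_linear.continuous_on[OF L])
next
  case (Suc k)
  show ?case
    by (rule ck_on_SucI[OF \<open>open S\<close> bounded_linear.has_derivative[OF L ck_on_has_derivative[OF Suc.prems]]])
      (use Suc in auto)
qed

lemma ck_on_add:
  assumes "open S" and "ck_on k S f" and "ck_on k S g"
  shows "ck_on k S (\<lambda>m. f m + g m)"
  using assms(2,3)
proof (induction k arbitrary: f g)
  case 0
  then show ?case by (simp add: continuous_on_add)
next
  case (Suc k)
  show ?case
    by (rule ck_on_SucI[OF \<open>open S\<close> has_derivative_add[OF
          ck_on_has_derivative[OF Suc.prems(1)] ck_on_has_derivative[OF Suc.prems(2)]]])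
      (use Suc in auto)
qed

lemma ck_on_Pair:
  assumes "open S" and "ck_on k S f" and "ck_on k S g"
  shows "ck_on k S (\<lambda>m. (f m, g m))"
  using assms(2,3)
proof (induction k arbitrary: f g)
  case 0
  then show ?case by (simp add: continuous_on_Pair)
next
  case (Suc k)
  show ?case
    by (rule ck_on_SucI[OF \<open>open S\<close> has_derivative_Pair[OF
          ck_on_has_derivative[OF Suc.prems(1)] ck_on_has_derivative[OF Suc.prems(2)]]])
      (use Suc in auto)
qed

lemma ck_on_mult:
  fixes f g :: "'a::real_normed_vector \<Rightarrow> 'b::real_normed_algebra"
  assumes "open S" and "ck_on k S f" and "ck_on k S g"
  shows "ck_on k S (\<lambda>m. f m * g m)"
  using assms(2,3)
proof (induction k arbitrary: f g)
  case 0
  then show ?case by (simp add: continuous_on_mult)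
next
  case (Suc k)
  show ?case
    by (rule ck_on_SucI[OF \<open>open S\<close> has_derivative_mult[OF
          ck_on_has_derivative[OF Suc.prems(1)] ck_on_has_derivative[OF Suc.prems(2)]]])
      (use Suc.prems Suc.prems[THEN ck_on_Suc_imp_ck_on] in
        \<open>auto intro!: ck_on_add[OF \<open>open S\<close>] Suc.IH\<close>)
qed

lemma ck_on_inverse:
  fixes f :: "'a::real_normed_vector \<Rightarrow> 'b::real_normed_field"
  assumes "open S" and nz: "\<And>m. m \<in> S \<Longrightarrow> f m \<noteq> 0" and "ck_on k S f"
  shows "ck_on k S (\<lambda>m. inverse (f m))"
  using assms(3)
proof (induction k)
  case 0
  then show ?case using nz by (auto intro: continuous_on_inverse)
next
  case (Suc k)
  have "ck_on k S (\<lambda>m. inverse (f m))" using Suc ck_on_Suc_imp_ck_on by blast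
  then have "ck_on k S (\<lambda>m. (- 1) * (inverse (f m) * frechet_derivative f (at m) v * inverse (f m)))" for v
    using Suc.prems by (intro ck_on_mult ck_on_const \<open>open S\<close>) auto
  then show ?case
    by (intro ck_on_SucI[OF \<open>open S\<close> Deriv.has_derivative_inverse[OF nz ck_on_has_derivative[OF Suc.prems]]])
     auto
qed

lemma smooth_on_cong:
  "open S \<Longrightarrow> (\<And>m. m \<in> S \<Longrightarrow> f m = g m) \<Longrightarrow> smooth_on S f \<longleftrightarrow> smooth_on S g"
  unfolding smooth_on_def using ck_on_cong by blast

lemma smooth_on_const: "smooth_on S (\<lambda>m. c)"
  by (simp add: smooth_on_def ck_on_const)

lemma smooth_on_bounded_linear: "bounded_linear L \<Longrightarrow> smooth_on S L"
  by (simp add: smooth_on_def ck_on_bounded_linear)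

lemma smooth_on_linear_compose:
  "open S \<Longrightarrow> bounded_linear L \<Longrightarrow> smooth_on S f \<Longrightarrow> smooth_on S (\<lambda>m. L (f m))"
  by (simp add: smooth_on_def ck_on_linear_compose)

lemma smooth_on_add:
  "open S \<Longrightarrow> smooth_on S f \<Longrightarrow> smooth_on S g \<Longrightarrow> smooth_on S (\<lambda>m. f m + g m)"
  by (simp add: smooth_on_def ck_on_add)

lemma smooth_on_Pair:
  "open S \<Longrightarrow> smooth_on S f \<Longrightarrow> smooth_on S g \<Longrightarrow> smooth_on S (\<lambda>m. (f m, g m))"
  by (simp add: smooth_on_def ck_on_Pair)

lemma smooth_on_mult:
  fixes f g :: "'a::real_normed_vector \<Rightarrow> 'b::real_normed_algebra"
  shows "open S \<Longrightarrow> smooth_on S f \<Longrightarrow> smooth_on S g \<Longrightarrow> smooth_on S (\<lambda>m. f m * g m)"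
  by (simp add: smooth_on_def ck_on_mult)

lemma smooth_on_uminus: "open S \<Longrightarrow> smooth_on S f \<Longrightarrow> smooth_on S (\<lambda>m. - f m)"
  by (rule smooth_on_linear_compose[of S uminus]) (auto intro: bounded_linear_minus bounded_linear_ident)

lemma smooth_on_diff:
  "open S \<Longrightarrow> smooth_on S f \<Longrightarrow> smooth_on S g \<Longrightarrow> smooth_on S (\<lambda>m. f m - g m)"
  using smooth_on_add[of S f "\<lambda>m. - g m"] smooth_on_uminus[of S g] by simp

lemma smooth_on_divide:
  fixes f g :: "'a::real_normed_vector \<Rightarrow> 'b::real_normed_field"
  assumes "open S" "\<And>m. m \<in> S \<Longrightarrow> g m \<noteq> 0" "smooth_on S f" "smooth_on S g"
  shows "smooth_on S (\<lambda>m. f m / g m)"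
  using assms by (auto simp: divide_inverse smooth_on_def intro!: ck_on_mult ck_on_inverse)

lemma smooth_on_power:
  fixes f :: "'a::real_normed_vector \<Rightarrow> 'b::real_normed_field"
  shows "open S \<Longrightarrow> smooth_on S f \<Longrightarrow> smooth_on S (\<lambda>m. f m ^ n)"
  by (induction n) (auto intro: smooth_on_const smooth_on_mult)

lemma smooth_on_frechet_derivative:
  "smooth_on S f \<Longrightarrow> smooth_on S (\<lambda>m. frechet_derivative f (at m) v)"
  by (metis ck_on.simps(2) smooth_on_def)

lemma smooth_on_has_derivative:
  "smooth_on S f \<Longrightarrow> m \<in> S \<Longrightarrow> (f has_derivative frechet_derivative f (at m)) (at m)"
  using ck_on_has_derivative unfolding smooth_on_def by blast

lemma smooth_on_imp_continuous_on: "smooth_on S f \<Longrightarrow> continuous_on S f"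
  by (metis ck_on.simps(1) smooth_on_def)

lemma smooth_on_DERIV_line:
  fixes f :: "'a::real_normed_vector \<Rightarrow> real"
  assumes "smooth_on S f" "m + t *\<^sub>R v \<in> S"
  shows "((\<lambda>t. f (m + t *\<^sub>R v)) has_field_derivative frechet_derivative f (at (m + t *\<^sub>R v)) v) (at t)"
proof -
  interpret D: linear "frechet_derivative f (at (m + t *\<^sub>R v))"
    using smooth_on_has_derivative[OF assms] has_derivative_linear by blast
  have "((\<lambda>t. f (m + t *\<^sub>R v)) has_derivative (\<lambda>h. frechet_derivative f (at (m + t *\<^sub>R v)) (h *\<^sub>R v))) (at t)"
    by (rule has_derivative_compose[of "\<lambda>t. m + t *\<^sub>R v" "\<lambda>h. h *\<^sub>R v" t UNIV f,
          OF _ smooth_on_has_derivative[OF assms]])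
      (auto intro!: derivative_eq_intros)
  then show ?thesis
    by (simp add: has_field_derivative_def D.scaleR mult_commute_abs)
qed

text \<open>The second difference is symmetric in \<open>u\<close> and \<open>v\<close>, and two applications of the mean value theorem
  express it by the iterated derivative in either order.\<close>

lemma second_difference_mean_value:
  fixes f :: "'a::real_normed_vector \<Rightarrow> real"
  assumes f: "smooth_on S f" and t: "0 < t"
    and S: "\<And>a b. 0 \<le> a \<Longrightarrow> a \<le> t \<Longrightarrow> 0 \<le> b \<Longrightarrow> b \<le> t \<Longrightarrow> m + a *\<^sub>R u + b *\<^sub>R v \<in> S"
  obtains a b where "0 < a" "a < t" "0 < b" "b < t"
    "f (m + t *\<^sub>R u + t *\<^sub>R v) - f (m + t *\<^sub>R u) - f (m + t *\<^sub>R v) + f m =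
      t\<^sup>2 * frechet_derivative (\<lambda>m. frechet_derivative f (at m) u) (at (m + a *\<^sub>R u + b *\<^sub>R v)) v"
proof -
  define D where "D = (\<lambda>m. frechet_derivative f (at m) u)"
  define \<phi> where "\<phi> = (\<lambda>s. f (m + t *\<^sub>R v + s *\<^sub>R u) - f (m + s *\<^sub>R u))"
  have "(\<phi> has_field_derivative D (m + t *\<^sub>R v + s *\<^sub>R u) - D (m + s *\<^sub>R u)) (at s)"
    if "0 \<le> s" "s \<le> t" for s
    unfolding \<phi>_def D_def
    by (intro DERIV_diff smooth_on_DERIV_line[OF f])
      (use S[OF that, of t] S[OF that, of 0] t in \<open>auto simp: algebra_simps\<close>)
  from MVT2[OF t this] obtain a where a: "0 < a" "a < t"
    "\<phi> t - \<phi> 0 = t * (D (m + t *\<^sub>R v + a *\<^sub>R u) - D (m + a *\<^sub>R u))"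
    by auto
  have "((\<lambda>s. D (m + a *\<^sub>R u + s *\<^sub>R v)) has_field_derivative
      frechet_derivative D (at (m + a *\<^sub>R u + s *\<^sub>R v)) v) (at s)" if "0 \<le> s" "s \<le> t" for s
    by (rule smooth_on_DERIV_line[of S])
      (use f S[of a s] that a in \<open>auto simp: D_def intro: smooth_on_frechet_derivative\<close>)
  from MVT2[OF t this] obtain b where b: "0 < b" "b < t"
    "D (m + a *\<^sub>R u + t *\<^sub>R v) - D (m + a *\<^sub>R u) = t * frechet_derivative D (at (m + a *\<^sub>R u + b *\<^sub>R v)) v"
    by auto
  show ?thesis
    by (rule that[OF a(1,2) b(1,2)])
      (use a(3) b(3) in \<open>simp add: \<phi>_def D_def algebra_simps power2_eq_square\<close>)
qed

text \<open>Schwarz's theorem: by the mean value property of the second difference, the two iterated derivatives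
  take equal values at two points arbitrarily close to \<open>m\<close>, so by continuity they agree at \<open>m\<close>.\<close>

lemma frechet_derivative_commute:
  fixes f :: "'a::real_normed_vector \<Rightarrow> real"
  assumes S: "open S" "m \<in> S" and f: "smooth_on S f"
  shows "frechet_derivative (\<lambda>m. frechet_derivative f (at m) u) (at m) v =
    frechet_derivative (\<lambda>m. frechet_derivative f (at m) v) (at m) u"
proof -
  define D where "D u v m = frechet_derivative (\<lambda>m. frechet_derivative f (at m) u) (at m) v" for u v m
  have "\<bar>D u v m - D v u m\<bar> < e" if "0 < e" for e
  proof -
    have "isCont (D u v) m" "isCont (D v u) m"
      unfolding D_def using S f
      by (auto intro!: continuous_on_interior[of S] smooth_on_imp_continuous_on
          smooth_on_frechet_derivative simp: interior_open)
    then have "eventually (\<lambda>n. dist (D u v n) (D u v m) < e / 2) (nhds m)"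
      "eventually (\<lambda>n. dist (D v u n) (D v u m) < e / 2) (nhds m)"
      using that by (auto simp: isCont_def tendsto_iff eventually_at_filter elim: eventually_mono
          dest!: spec[of _ "e/2"])
    moreover have "eventually (\<lambda>n. n \<in> S) (nhds m)" using S by (rule eventually_nhds_in_open)
    ultimately have "eventually (\<lambda>n. dist (D u v n) (D u v m) < e / 2 \<and> dist (D v u n) (D v u m) < e / 2
        \<and> n \<in> S) (nhds m)"
      by eventually_elim simp
    then obtain d where d: "0 < d"
      "\<And>n. dist n m < d \<Longrightarrow> dist (D u v n) (D u v m) < e / 2 \<and> dist (D v u n) (D v u m) < e / 2 \<and> n \<in> S"
      by (auto simp: eventually_nhds_metric)
    define t where "t = d / (2 * (norm u + norm v + 1))"
    have t: "0 < t" using d by (simp add: t_def add_nonneg_pos)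
    have near: "dist (m + a *\<^sub>R u + b *\<^sub>R v) m < d" if "0 \<le> a" "a \<le> t" "0 \<le> b" "b \<le> t" for a b
    proof -
      have "dist (m + a *\<^sub>R u + b *\<^sub>R v) m = norm (a *\<^sub>R u + b *\<^sub>R v)"
        by (simp add: dist_norm add.assoc)
      also have "\<dots> \<le> norm (a *\<^sub>R u) + norm (b *\<^sub>R v)" by (rule norm_triangle_ineq)
      also have "\<dots> \<le> t * norm u + t * norm v"
        using that by (intro add_mono) (auto intro: mult_right_mono)
      also have "\<dots> < d"
      proof -
        have "t * norm u + t * norm v \<le> t * (norm u + norm v + 1)" using t by (simp add: algebra_simps)
        also have "\<dots> = d / 2"
          using add_nonneg_pos[of "norm u + norm v" 1] by (simp add: t_def field_simps)
        also have "\<dots> < d" using d by simp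
        finally show ?thesis .
      qed
      finally show ?thesis .
    qed
    obtain a b where ab: "0 < a" "a < t" "0 < b" "b < t"
      "f (m + t *\<^sub>R u + t *\<^sub>R v) - f (m + t *\<^sub>R u) - f (m + t *\<^sub>R v) + f m = t\<^sup>2 * D u v (m + a *\<^sub>R u + b *\<^sub>R v)"
      using second_difference_mean_value[OF f t, of m u v] near d(2) unfolding D_def by metis
    obtain a' b' where ab': "0 < a'" "a' < t" "0 < b'" "b' < t"
      "f (m + t *\<^sub>R v + t *\<^sub>R u) - f (m + t *\<^sub>R v) - f (m + t *\<^sub>R u) + f m = t\<^sup>2 * D v u (m + a' *\<^sub>R v + b' *\<^sub>R u)"
    proof (rule second_difference_mean_value[OF f t, of m v u])
      show "m + a *\<^sub>R v + b *\<^sub>R u \<in> S" if "0 \<le> a" "a \<le> t" "0 \<le> b" "b \<le> t" for a b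
        using d(2)[OF near[of b a]] that by (simp add: algebra_simps)
    qed (use that in \<open>auto simp: D_def\<close>)
    have "t\<^sup>2 * D u v (m + a *\<^sub>R u + b *\<^sub>R v) = t\<^sup>2 * D v u (m + a' *\<^sub>R v + b' *\<^sub>R u)"
      using ab(5) ab'(5) by (simp add: algebra_simps)
    then have "D u v (m + a *\<^sub>R u + b *\<^sub>R v) = D v u (m + b' *\<^sub>R u + a' *\<^sub>R v)"
      using t by (simp add: algebra_simps)
    moreover have "dist (D u v (m + a *\<^sub>R u + b *\<^sub>R v)) (D u v m) < e / 2"
      "dist (D v u (m + b' *\<^sub>R u + a' *\<^sub>R v)) (D v u m) < e / 2"
      using ab ab' d(2)[OF near[of a b]] d(2)[OF near[of b' a']] by auto
    ultimately show ?thesis unfolding dist_real_def by linarith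
  qed
  then have "\<bar>D u v m - D v u m\<bar> = 0" by (metis abs_ge_zero less_irrefl order_le_less)
  then show ?thesis by (simp add: D_def)
qed

section \<open>The balanced metric and the Kaehler property\<close>

lemma open_siegel_jacobi: "open siegel_jacobi"
proof -
  have "open {m::complex \<times> complex. 0 < Im (fst m)}" by (intro open_Collect_less continuous_intros)
  also have "{m. 0 < Im (fst m)} = siegel_jacobi" by (auto simp: siegel_jacobi_def)
  finally show ?thesis .
qed

lemma open_coord_domain: "open coord_domain"
proof -
  have "open {m::real4. 0 < fst (snd m)}" by (intro open_Collect_less continuous_intros)
  also have "{m. 0 < fst (snd m)} = coord_domain" by (auto simp: coord_domain_def)
  finally show ?thesis .
qed

lemma balanced_ds2_eq:
  assumes "Im \<tau> > 0"
  shows "balanced_ds2 c1 c2 (\<tau>, z) (d\<tau>, dz) = complex_of_real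
    (c1 / (4 * (Im \<tau>)\<^sup>2) * (norm d\<tau>)\<^sup>2 + c2 / Im \<tau> * (norm (dz - (Im z / Im \<tau>) *\<^sub>R d\<tau>))\<^sup>2)"
proof -
  define p where "p = complex_of_real (Im z / Im \<tau>)"
  have p: "(z - cnj z) / (\<tau> - cnj \<tau>) = p"
    using assms by (simp add: complex_diff_cnj p_def)
  have "(dz - p * d\<tau>) * (cnj dz - p * cnj d\<tau>) = (dz - p * d\<tau>) * cnj (dz - p * d\<tau>)"
    by (simp add: p_def)
  also have "\<dots> = of_real ((norm (dz - p * d\<tau>))\<^sup>2)"
    by (simp only: complex_norm_square)
  finally have fibre: "(dz - p * d\<tau>) * (cnj dz - p * cnj d\<tau>) = of_real ((norm (dz - p * d\<tau>))\<^sup>2)" .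
  have base: "d\<tau> * cnj d\<tau> = of_real ((norm d\<tau>)\<^sup>2)"
    by (simp only: complex_norm_square)
  have 1: "- complex_of_real c1 * (d\<tau> * cnj d\<tau>) / (\<tau> - cnj \<tau>)\<^sup>2 =
      complex_of_real (c1 / (4 * (Im \<tau>)\<^sup>2) * (norm d\<tau>)\<^sup>2)"
    unfolding base by (simp add: complex_diff_cnj power_mult_distrib)
  have 2: "2 * \<i> * complex_of_real c2 / (\<tau> - cnj \<tau>) = of_real (c2 / Im \<tau>)"
    using assms by (simp add: complex_diff_cnj)
  have "balanced_ds2 c1 c2 (\<tau>, z) (d\<tau>, dz) =
      complex_of_real (c1 / (4 * (Im \<tau>)\<^sup>2) * (norm d\<tau>)\<^sup>2) +
      of_real (c2 / Im \<tau>) * of_real ((norm (dz - p * d\<tau>))\<^sup>2)"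
    unfolding balanced_ds2_def by (simp only: prod.case Let_def p mult.assoc fibre 1 2 flip: fibre)
      (simp only: fibre flip: 1 2 mult.assoc)
  then show ?thesis by (simp add: p_def scaleR_conv_of_real)
qed

text \<open>The hyperbolic metric of the base plus a Euclidean metric on the fibre, in the form used for
  everything that follows.\<close>

lemma balanced_metric_eq:
  assumes "Im \<tau> > 0"
  shows "balanced_metric c1 c2 (\<tau>, z) (v1, v2) (w1, w2) =
    c1 / (4 * (Im \<tau>)\<^sup>2) * (v1 \<bullet> w1) +
    c2 / Im \<tau> * ((v2 - (Im z / Im \<tau>) *\<^sub>R v1) \<bullet> (w2 - (Im z / Im \<tau>) *\<^sub>R w1))"
proof -
  have polar: "(norm (a + b))\<^sup>2 - (norm (a - b))\<^sup>2 = 4 * (a \<bullet> b)" for a b :: complex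
    by (simp add: power2_norm_eq_inner inner_add_left inner_add_right inner_diff_left inner_diff_right
        inner_commute)
  define p where "p = Im z / Im \<tau>"
  have sum: "v2 + w2 - p *\<^sub>R (v1 + w1) = (v2 - p *\<^sub>R v1) + (w2 - p *\<^sub>R w1)"
    and diff: "v2 - w2 - p *\<^sub>R (v1 - w1) = (v2 - p *\<^sub>R v1) - (w2 - p *\<^sub>R w1)"
    by (simp_all add: algebra_simps)
  have "balanced_metric c1 c2 (\<tau>, z) (v1, v2) (w1, w2) =
      (c1 / (4 * (Im \<tau>)\<^sup>2) * ((norm (v1 + w1))\<^sup>2 - (norm (v1 - w1))\<^sup>2) +
       c2 / Im \<tau> * ((norm ((v2 - p *\<^sub>R v1) + (w2 - p *\<^sub>R w1)))\<^sup>2 - (norm ((v2 - p *\<^sub>R v1) - (w2 - p *\<^sub>R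
           w1)))\<^sup>2)) / 4"
    using assms by (simp add: balanced_metric_def balanced_ds2_eq p_def[symmetric] sum diff right_diff_distrib)
  also have "\<dots> = c1 / (4 * (Im \<tau>)\<^sup>2) * (v1 \<bullet> w1) + c2 / Im \<tau> * ((v2 - p *\<^sub>R v1) \<bullet> (w2 - p *\<^sub>R w1))"
    unfolding polar by (simp add: field_simps)
  finally show ?thesis by (simp add: p_def)
qed

lemma balanced_ds2_eq_metric:
  assumes "m \<in> siegel_jacobi"
  shows "balanced_ds2 c1 c2 m v = complex_of_real (balanced_metric c1 c2 m v v)"
  using assms by (cases m; cases v)
    (simp add: siegel_jacobi_def balanced_ds2_eq balanced_metric_eq power2_norm_eq_inner)

text \<open>For constant tangent vectors this is a polynomial in \<open>Im z\<close> and \<open>1 / Im \<tau>\<close>, which is how the metric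
  is differentiated.\<close>

lemma balanced_metric_expand:
  assumes "m \<in> siegel_jacobi"
  shows "balanced_metric c1 c2 m v w =
    (c1 / 4 * (fst v \<bullet> fst w)) / (Im (fst m))\<^sup>2 + c2 * ((snd v \<bullet> snd w) / Im (fst m)
      - Im (snd m) * (fst v \<bullet> snd w + snd v \<bullet> fst w) / (Im (fst m))\<^sup>2
      + (Im (snd m))\<^sup>2 * (fst v \<bullet> fst w) / (Im (fst m)) ^ 3)"
  using assms by (cases m; cases v; cases w)
    (auto simp: siegel_jacobi_def balanced_metric_eq inner_diff_left inner_diff_right field_simps
      power2_eq_square power3_eq_cube)

lemma balanced_metric_has_derivative:
  assumes "m \<in> siegel_jacobi"
  shows "((\<lambda>m. balanced_metric c1 c2 m v w) has_derivative (\<lambda>u.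
    - (c1 / 2 * (fst v \<bullet> fst w)) * Im (fst u) / (Im (fst m)) ^ 3
    + c2 * (- (snd v \<bullet> snd w) * Im (fst u) / (Im (fst m))\<^sup>2
      - (fst v \<bullet> snd w + snd v \<bullet> fst w) *
          (Im (snd u) / (Im (fst m))\<^sup>2 - 2 * Im (snd m) * Im (fst u) / (Im (fst m)) ^ 3)
      + (fst v \<bullet> fst w) * (2 * Im (snd m) * Im (snd u) / (Im (fst m)) ^ 3
          - 3 * (Im (snd m))\<^sup>2 * Im (fst u) / (Im (fst m)) ^ 4)))) (at m)"
proof -
  have nz: "Im (fst m) \<noteq> 0" using assms by (auto simp: siegel_jacobi_def)
  show ?thesis
    by (rule has_derivative_transform_within_open[OF _ open_siegel_jacobi assms balanced_metric_expand[symmetric]],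
        (rule derivative_eq_intros refl nz power_not_zero)+,
        simp add: fun_eq_iff nz field_simps power2_eq_square power3_eq_cube power4_eq_xxxx, assumption)
qed

lemma riemannian_balanced_metric:
  assumes "c1 > 0" "c2 > 0"
  shows "riemannian_on siegel_jacobi (balanced_metric c1 c2)"
  unfolding riemannian_on_def
proof (intro conjI ballI allI impI)
  fix m assume m: "m \<in> siegel_jacobi"
  then obtain \<tau> z where mz: "m = (\<tau>, z)" "Im \<tau> > 0" by (auto simp: siegel_jacobi_def)
  show "bilinear (balanced_metric c1 c2 m)"
    using mz by (auto simp: bilinear_def balanced_metric_eq algebra_simps add_divide_distrib inner_simps
        intro!: linearI)
  show "balanced_metric c1 c2 m v w = balanced_metric c1 c2 m w v" for v w
    using mz by (cases v; cases w) (simp add: balanced_metric_eq inner_commute)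
  show "balanced_metric c1 c2 m v v > 0" if "v \<noteq> 0" for v
  proof -
    obtain v1 v2 where v: "v = (v1, v2)" by (cases v)
    define k l e where "k = c1 / (4 * (Im \<tau>)\<^sup>2)" and "l = c2 / Im \<tau>"
      and "e = v2 - (Im z / Im \<tau>) *\<^sub>R v1"
    have kl: "k > 0" "l > 0" using assms mz by (auto simp: k_def l_def)
    have "k * (v1 \<bullet> v1) + l * (e \<bullet> e) > 0"
    proof (cases "v1 = 0")
      case True
      then have "e \<noteq> 0" using that v by (simp add: e_def zero_prod_def)
      then show ?thesis using True kl by simp
    next
      case False
      then show ?thesis using kl by (intro add_pos_nonneg mult_pos_pos mult_nonneg_nonneg) auto
    qed
    then show ?thesis using mz by (simp add: v balanced_metric_eq k_def l_def e_def)
  qed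
next
  fix v w :: "complex \<times> complex"
  have lin: "smooth_on siegel_jacobi (\<lambda>m. Im (fst m))" "smooth_on siegel_jacobi (\<lambda>m. Im (snd m))"
    by (intro smooth_on_bounded_linear bounded_linear_compose[OF bounded_linear_Im]
        bounded_linear_fst bounded_linear_snd)+
  show "smooth_on siegel_jacobi (\<lambda>m. balanced_metric c1 c2 m v w)"
    by (subst smooth_on_cong[OF open_siegel_jacobi balanced_metric_expand], assumption)
      (intro smooth_on_add smooth_on_diff smooth_on_mult smooth_on_divide smooth_on_power
        smooth_on_const lin open_siegel_jacobi; auto simp: siegel_jacobi_def)
qed

lemma kaehler_balanced_metric:
  assumes "c1 > 0" "c2 > 0"
  shows "kaehler_on siegel_jacobi (balanced_metric c1 c2)"
  unfolding kaehler_on_def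
proof (intro conjI ballI allI)
  show "riemannian_on siegel_jacobi (balanced_metric c1 c2)"
    using assms by (rule riemannian_balanced_metric)
next
  fix m v w assume "m \<in> siegel_jacobi"
  then show "balanced_metric c1 c2 m (cpx_structure v) (cpx_structure w) = balanced_metric c1 c2 m v w"
    by (simp add: balanced_metric_expand cpx_structure_def inner_complex_def algebra_simps)
next
  show "closed_2form_on siegel_jacobi (\<lambda>m v. balanced_metric c1 c2 m (cpx_structure v))"
    unfolding closed_2form_on_def
  proof (intro ballI allI)
    fix m u v w :: "complex \<times> complex" assume m: "m \<in> siegel_jacobi"
    define y2 y3 y4 \<eta> where "y2 = inverse ((Im (fst m))\<^sup>2)" and "y3 = inverse (Im (fst m) ^ 3)"
      and "y4 = inverse (Im (fst m) ^ 4)" and "\<eta> = Im (snd m)"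
    obtain u1 u2 u3 u4 v1 v2 v3 v4 w1 w2 w3 w4 where
      "u = (Complex u1 u2, Complex u3 u4)" "v = (Complex v1 v2, Complex v3 v4)"
      "w = (Complex w1 w2, Complex w3 w4)"
      by (metis complex.exhaust prod.exhaust)
    then show "frechet_derivative (\<lambda>m. balanced_metric c1 c2 m (cpx_structure v) w) (at m) u +
      frechet_derivative (\<lambda>m. balanced_metric c1 c2 m (cpx_structure w) u) (at m) v +
      frechet_derivative (\<lambda>m. balanced_metric c1 c2 m (cpx_structure u) v) (at m) w = 0"
      unfolding frechet_derivative_at[OF balanced_metric_has_derivative[OF m], symmetric]
      by (simp only: cpx_structure_def inner_complex_def divide_inverse fst_conv snd_conv
          times_complex.sel complex.sel imaginary_unit.sel mult_zero_left mult_1 add_0 diff_0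
          y2_def[symmetric] y3_def[symmetric] y4_def[symmetric] \<eta>_def[symmetric])
        (simp add: algebra_simps)
  qed
qed

section \<open>Invariance under the reduced Jacobi group\<close>

lemma jacobi_act_has_derivative:
  assumes "det M = 1" "Im \<tau> > 0"
  defines "j \<equiv> complex_of_real (M $ 2 $ 1) * \<tau> + complex_of_real (M $ 2 $ 2)"
  shows "(jacobi_act (M, X) has_derivative (\<lambda>(u, w). (u / j\<^sup>2,
    (w + complex_of_real (X $ 1) * u) / j
      - complex_of_real (M $ 2 $ 1) * (z + complex_of_real (X $ 1) * \<tau> + complex_of_real (X $ 2)) * u / j\<^sup>2)))
    (at (\<tau>, z))"
proof -
  define a b c d where "a = M $ 1 $ 1" and "b = M $ 1 $ 2" and "c = M $ 2 $ 1" and "d = M $ 2 $ 2"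
  have det: "complex_of_real a * complex_of_real d - complex_of_real b * complex_of_real c = 1"
    using assms(1) unfolding det_2 a_def b_def c_def d_def by (metis of_real_1 of_real_diff of_real_mult)
  have j: "j = of_real c * \<tau> + of_real d" "j \<noteq> 0"
  proof -
    show eq: "j = of_real c * \<tau> + of_real d" by (simp add: j_def c_def d_def)
    show "j \<noteq> 0"
    proof
      assume "j = 0"
      then have "c = 0" "d = 0" using assms(2) by (auto simp: eq complex_eq_iff)
      then show False using det by simp
    qed
  qed
  have act: "jacobi_act (M, X) = (\<lambda>m. ((of_real a * fst m + of_real b) / (of_real c * fst m + of_real d),
      (snd m + of_real (X $ 1) * fst m + of_real (X $ 2)) / (of_real c * fst m + of_real d)))"
    by (auto simp: jacobi_act_def Let_def a_def b_def c_def d_def fun_eq_iff)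
  have 1: "(of_real a * u * j - (of_real a * \<tau> + of_real b) * (of_real c * u)) / (j * j) = u / j\<^sup>2" for u
  proof -
    have "of_real a * u * j - (of_real a * \<tau> + of_real b) * (of_real c * u) = u"
      using det unfolding j(1) by algebra
    then show ?thesis by (simp add: power2_eq_square)
  qed
  have 2: "((w + of_real (X $ 1) * u) * j - (z + of_real (X $ 1) * \<tau> + of_real (X $ 2)) * (of_real c * u)) / (j * j)
      = (w + of_real (X $ 1) * u) / j - of_real c * (z + of_real (X $ 1) * \<tau> + of_real (X $ 2)) * u / j\<^sup>2" for u w
    using j(2) by (simp add: divide_simps power2_eq_square)
  have "(jacobi_act (M, X) has_derivative (\<lambda>m.
    ((of_real a * fst m * j - (of_real a * \<tau> + of_real b) * (of_real c * fst m)) / (j * j),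
     ((snd m + of_real (X $ 1) * fst m) * j - (z + of_real (X $ 1) * \<tau>
         + of_real (X $ 2)) * (of_real c * fst m)) / (j * j))))
    (at (\<tau>, z))"
    unfolding act j(1) using j(2)[unfolded j(1)]
    by (intro has_derivative_Pair has_derivative_divide') (auto intro!: derivative_eq_intros)
  then show ?thesis unfolding 1 2 by (simp add: case_prod_beta' c_def)
qed

lemma inner_mult_complex: "(k * v) \<bullet> (k * w) = (norm k)\<^sup>2 * (v \<bullet> w)" for k v w :: complex
  by (simp add: inner_complex_def cmod_power2) algebra

text \<open>The key point is that \<open>dz - p d\<tau>\<close> is multiplied by \<open>1 / j\<close>. This holds because the action on the
  real coordinates \<open>(p, q)\<close> is affine: \<open>z = p \<tau> + q\<close> is sent to \<open>p' \<tau>' + q'\<close> with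
  \<open>(p', q') = (p + \<lambda>, q + \<mu>) M\<^sup>-\<^sup>1\<close>, where \<open>p'\<close> and \<open>q'\<close> are real.\<close>

lemma jacobi_act_preserves_metric:
  assumes "h \<in> carrier reduced_jacobi"
  shows "preserves_metric_on siegel_jacobi (balanced_metric c1 c2) (jacobi_act h)"
  unfolding preserves_metric_on_def
proof (intro ballI conjI allI)
  fix m v w :: "complex \<times> complex" assume "m \<in> siegel_jacobi"
  then obtain \<tau> z where m: "m = (\<tau>, z)" and \<tau>: "Im \<tau> > 0" by (auto simp: siegel_jacobi_def)
  obtain M X where h: "h = (M, X)" and M: "det M = 1"
    using assms by (auto simp: reduced_jacobi_def)
  define a b c d where "a = M $ 1 $ 1" and "b = M $ 1 $ 2" and "c = M $ 2 $ 1" and "d = M $ 2 $ 2"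
  have det: "a * d - b * c = 1" using M by (simp add: det_2 a_def b_def c_def d_def)
  then have detc: "complex_of_real a * of_real d - of_real b * of_real c = 1"
    by (metis of_real_1 of_real_diff of_real_mult)
  define j where "j = complex_of_real c * \<tau> + complex_of_real d"
  have "j \<noteq> 0"
  proof
    assume "j = 0"
    then have "c = 0" "d = 0" using \<tau> by (auto simp: j_def complex_eq_iff)
    then show False using det by simp
  qed
  define p q where "p = Im z / Im \<tau>" and "q = Re z - p * Re \<tau>"
  have z: "z = of_real p * \<tau> + of_real q"
    using \<tau> by (simp add: p_def q_def complex_eq_iff)
  define p1 q1 where "p1 = p + X $ 1" and "q1 = q + X $ 2"
  define p' q' where "p' = p1 * d - q1 * c" and "q' = q1 * a - p1 * b"
  define \<tau>' z' where "\<tau>' = (of_real a * \<tau> + of_real b) / j" and "z' = (of_real p1 * \<tau> + of_real q1) / j"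
  have act: "jacobi_act h m = (\<tau>', z')"
    by (simp add: jacobi_act_def h m Let_def \<tau>'_def z'_def j_def a_def b_def c_def d_def z p1_def q1_def
        algebra_simps)
  have Im: "Im \<tau>' = Im \<tau> / (norm j)\<^sup>2"
  proof -
    have "Im \<tau>' = Im ((of_real a * \<tau> + of_real b) * cnj j) / (norm j)\<^sup>2"
      unfolding \<tau>'_def by (subst complex_div_cnj) simp
    also have "Im ((of_real a * \<tau> + of_real b) * cnj j) = (a * d - b * c) * Im \<tau>"
      by (simp add: j_def algebra_simps)
    finally show ?thesis using det by simp
  qed
  then have Im_pos: "Im \<tau>' > 0" using \<tau> \<open>j \<noteq> 0\<close> by simp
  then show "jacobi_act h m \<in> siegel_jacobi" by (simp add: act siegel_jacobi_def)
  note D = jacobi_act_has_derivative[OF M \<tau>, of X z, folded h m c_def d_def, folded j_def]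
  show "jacobi_act h differentiable (at m)" using D unfolding differentiable_def by blast
  have "z' = of_real p' * \<tau>' + of_real q'"
  proof -
    have "of_real p1 * \<tau> + of_real q1 = of_real p' * (of_real a * \<tau> + of_real b) + of_real q' * j"
      using detc unfolding j_def p'_def q'_def of_real_diff of_real_mult by algebra
    then show ?thesis using \<open>j \<noteq> 0\<close> by (simp add: z'_def \<tau>'_def field_simps)
  qed
  then have p': "Im z' / Im \<tau>' = p'" using Im_pos by simp
  have fibre: "((w + of_real (X $ 1) * u) / j
      - of_real c * (z + of_real (X $ 1) * \<tau> + of_real (X $ 2)) * u / j\<^sup>2) - p' *\<^sub>R (u / j\<^sup>2)
    = (1 / j) * (w - p *\<^sub>R u)" for u w
  proof -
    have "(w + of_real (X $ 1) * u) * j - of_real c * (z + of_real (X $ 1) * \<tau>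
        + of_real (X $ 2)) * u - of_real p' * u
      = j * (w - of_real p * u)"
      unfolding p'_def p1_def q1_def z j_def of_real_diff of_real_mult of_real_add by algebra
    then show ?thesis using \<open>j \<noteq> 0\<close>
      by (simp add: divide_simps scaleR_conv_of_real power2_eq_square)
  qed
  obtain v1 v2 w1 w2 where vw: "v = (v1, v2)" "w = (w1, w2)" by (metis prod.exhaust)
  have base: "(v1 / j\<^sup>2) \<bullet> (w1 / j\<^sup>2) = (v1 \<bullet> w1) / ((norm j)\<^sup>2)\<^sup>2"
    using inner_mult_complex[of "1 / j\<^sup>2" v1 w1] by (simp add: norm_divide norm_power power_divide)
  show "pullback (jacobi_act h) (balanced_metric c1 c2) m v w = balanced_metric c1 c2 m v w"
    unfolding pullback_def frechet_derivative_at[OF D, symmetric] act vw prod.case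
      balanced_metric_eq[OF Im_pos] p' fibre inner_mult_complex base
    using \<tau> \<open>j \<noteq> 0\<close>
    by (simp add: m balanced_metric_eq Im p_def[symmetric] norm_divide power_divide)
qed

section \<open>Real coordinates and the orthonormal frame\<close>

lemma from_xypq_has_derivative:
  "(from_xypq has_derivative (\<lambda>(dx, dy, dp, dq).
     (Complex dx dy, dp *\<^sub>R Complex x y + p *\<^sub>R Complex dx dy + of_real dq))) (at (x, y, p, q))"
proof -
  have eq: "from_xypq = (\<lambda>m. (of_real (fst m) + of_real (fst (snd m)) * \<i>,
      of_real (fst (snd (snd m))) * (of_real (fst m) + of_real (fst (snd m)) * \<i>)
        + of_real (snd (snd (snd m)))))"
    by (auto simp: from_xypq_def complex_eq_iff fun_eq_iff)
  show ?thesis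
    unfolding eq by (auto intro!: derivative_eq_intros ext simp: complex_eq_iff)
qed

lemma from_xyxieta_has_derivative:
  "(from_xyxieta has_derivative from_xyxieta) (at m)"
proof -
  have "from_xyxieta = (\<lambda>m. (of_real (fst m) + of_real (fst (snd m)) * \<i>,
      of_real (fst (snd (snd m))) + of_real (snd (snd (snd m))) * \<i>))"
    by (auto simp: from_xyxieta_def complex_eq_iff fun_eq_iff)
  moreover have "((\<lambda>m. (of_real (fst m) + of_real (fst (snd m)) * \<i>,
      of_real (fst (snd (snd m))) + of_real (snd (snd (snd m))) * \<i>)) has_derivative
    (\<lambda>m. (of_real (fst m) + of_real (fst (snd m)) * \<i>,
      of_real (fst (snd (snd m))) + of_real (snd (snd (snd m))) * \<i>))) (at m)"
    by (auto intro!: derivative_eq_intros)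
  ultimately show ?thesis by metis
qed

lemma metric_xypq_eq:
  assumes "y > 0"
  shows "metric_xypq c1 c2 (x, y, p, q) (v1, v2, v3, v4) (w1, w2, w3, w4) =
    c1 / (4 * y\<^sup>2) * (v1 * w1 + v2 * w2)
    + c2 / y * ((x\<^sup>2 + y\<^sup>2) * v3 * w3 + v4 * w4 + x * (v3 * w4 + v4 * w3))"
proof -
  have base: "from_xypq (x, y, p, q) = (Complex x y, Complex (p * x + q) (p * y))"
    by (simp add: from_xypq_def complex_eq_iff)
  have fibre: "(dp *\<^sub>R Complex x y + p *\<^sub>R Complex dx dy + of_real dq) - p *\<^sub>R Complex dx dy =
      Complex (dp * x + dq) (dp * y)" for dp dq dx dy
    by (simp add: complex_eq_iff)
  have p: "p * y / y = p" using assms by simp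
  have Im: "Im (Complex x y) > 0" using assms by simp
  show ?thesis
    unfolding metric_xypq_def pullback_def frechet_derivative_at[OF from_xypq_has_derivative, symmetric]
        base prod.case balanced_metric_eq[OF Im] complex.sel p fibre
    by (simp add: inner_complex_def power2_eq_square algebra_simps)
qed

lemma ds2_xypq_eq_metric:
  assumes "m \<in> coord_domain"
  shows "ds2_xypq c1 c2 m v = complex_of_real (metric_xypq c1 c2 m v v)"
  using assms unfolding ds2_xypq_def metric_xypq_def pullback_def
  by (intro balanced_ds2_eq_metric) (auto simp: coord_domain_def from_xypq_def siegel_jacobi_def)

lemma ds2_xyxieta_eq:
  assumes "y > 0"
  shows "ds2_xyxieta c1 c2 (x, y, \<xi>, \<eta>) (dx, dy, d\<xi>, d\<eta>) = complex_of_real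
    (c1 * (dx\<^sup>2 + dy\<^sup>2) / (4 * y\<^sup>2)
      + c2 / y * (d\<xi>\<^sup>2 + d\<eta>\<^sup>2 + (\<eta> / y)\<^sup>2 * (dx\<^sup>2 + dy\<^sup>2) - 2 * (\<eta> / y) * (dx * d\<xi> + dy * d\<eta>)))"
proof -
  have Im: "Im (Complex x y) > 0" using assms by simp
  have sq: "(d\<xi> - k * dx)\<^sup>2 + (d\<eta> - k * dy)\<^sup>2 =
      d\<xi>\<^sup>2 + d\<eta>\<^sup>2 + k\<^sup>2 * (dx\<^sup>2 + dy\<^sup>2) - 2 * k * (dx * d\<xi> + dy * d\<eta>)" for k
    by algebra
  have "c1 / (4 * y\<^sup>2) * (cmod (Complex dx dy))\<^sup>2
      + c2 / y * (cmod (Complex d\<xi> d\<eta> - (\<eta> / y) *\<^sub>R Complex dx dy))\<^sup>2 =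
    c1 * (dx\<^sup>2 + dy\<^sup>2) / (4 * y\<^sup>2)
      + c2 / y * (d\<xi>\<^sup>2 + d\<eta>\<^sup>2 + (\<eta> / y)\<^sup>2 * (dx\<^sup>2 + dy\<^sup>2) - 2 * (\<eta> / y) * (dx * d\<xi> + dy * d\<eta>))"
    unfolding cmod_power2 minus_complex.sel scaleR_complex.sel complex.sel real_scaleR_def sq by simp
  then show ?thesis
    unfolding ds2_xyxieta_def frechet_derivative_at[OF from_xyxieta_has_derivative, symmetric]
    unfolding from_xyxieta_def prod.case balanced_ds2_eq[OF Im] complex.sel by (rule arg_cong)
qed

text \<open>The polarised form of \<open>ds\<^sup>2 = \<lambda>\<^sub>1\<^sup>2 + \<lambda>\<^sub>2\<^sup>2 + \<lambda>\<^sub>4\<^sup>2 + \<lambda>\<^sub>5\<^sup>2\<close>. The first two forms are \<open>dx\<close>, \<open>dy\<close> rotated by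
  \<open>2 \<theta>\<close>, the last two are \<open>y\<^sup>1\<^sup>/\<^sup>2 dp\<close>, \<open>y\<^sup>-\<^sup>1\<^sup>/\<^sup>2 (dq + x dp)\<close> rotated by \<open>\<theta>\<close>, up to scale.
  Together with the duality of forms and frame it gives the orthonormality of the frame.\<close>

lemma metric_xypq_eq_sum_inv_form:
  assumes "\<alpha> > 0" "\<gamma> > 0" "m \<in> coord_domain"
  shows "metric_xypq (4 * \<alpha>) \<gamma> m v w = (\<Sum>i\<in>{1, 2, 4, 5}. inv_form \<alpha> \<gamma> \<theta> i m v * inv_form \<alpha> \<gamma> \<theta> i m w)"
proof -
  obtain x y p q v1 v2 v3 v4 w1 w2 w3 w4
    where eqs: "m = (x, y, p, q)" "v = (v1, v2, v3, v4)" "w = (w1, w2, w3, w4)"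
    by (metis prod.exhaust)
  define r s where "r = sqrt y" and "s = 1 / sqrt y"
  have r: "y = r\<^sup>2" "r > 0" "r * s = 1" using assms by (auto simp: r_def s_def eqs coord_domain_def)
  have y: "y > 0" using assms by (simp add: eqs coord_domain_def)
  have sy: "1 / y = s\<^sup>2" using y by (simp add: s_def power_divide)
  define C S where "C = cos \<theta>" and "S = sin \<theta>"
  define C2 S2 where "C2 = cos (2 * \<theta>)" and "S2 = sin (2 * \<theta>)"
  have trig: "S\<^sup>2 = 1 - C\<^sup>2" "S2\<^sup>2 = 1 - C2\<^sup>2"
    by (auto simp: C_def S_def C2_def S2_def sin_squared_eq)
  have base: "(C2 * v1 + S2 * v2) * (C2 * w1 + S2 * w2) + (- S2 * v1 + C2 * v2) * (- S2 * w1 + C2 * w2) =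
    v1 * w1 + v2 * w2"
    using trig by algebra
  have fibre: "(- s * S * v4 + (r * C - x * s * S) * v3) * (- s * S * w4 + (r * C - x * s * S) * w3) +
    (s * C * v4 + (r * S + x * s * C) * v3) * (s * C * w4 + (r * S + x * s * C) * w3) =
    s\<^sup>2 * ((x\<^sup>2 + (r\<^sup>2)\<^sup>2) * v3 * w3 + v4 * w4 + x * (v3 * w4 + v4 * w3))"
    using trig(1) r(3) by algebra
  have "(\<Sum>i\<in>{1, 2, 4, 5}. inv_form \<alpha> \<gamma> \<theta> i m v * inv_form \<alpha> \<gamma> \<theta> i m w) =
    (sqrt \<alpha> / y)\<^sup>2 * ((C2 * v1 + S2 * v2) * (C2 * w1 + S2 * w2) + (- S2 * v1 + C2 * v2) * (- S2 * w1 + C2 * w2))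
    + (sqrt \<gamma>)\<^sup>2 * ((- s * S * v4 + (r * C - x * s * S) * v3) * (- s * S * w4 + (r * C - x * s * S) * w3) +
    (s * C * v4 + (r * S + x * s * C) * v3) * (s * C * w4 + (r * S + x * s * C) * w3))"
    unfolding power2_eq_square C_def S_def C2_def S2_def r_def s_def
    by (simp add: eqs inv_form_def del: real_sqrt_mult_self mult_minus_left times_divide_eq_left
        times_divide_eq_right)
      algebra
  also have "\<dots> = metric_xypq (4 * \<alpha>) \<gamma> m v w"
    unfolding base fibre sy[symmetric] eqs metric_xypq_eq[OF y] using assms(1,2)
    by (simp add: power_divide r(1))
  finally show ?thesis by simp
qed

lemma inv_form_inv_frame:
  assumes "\<alpha> > 0" "\<gamma> > 0" "m \<in> coord_domain" "i \<in> {1, 2, 4, 5}" "j \<in> {1, 2, 4, 5}"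
  shows "inv_form \<alpha> \<gamma> \<theta> i m (inv_frame \<alpha> \<gamma> \<theta> j m) = (if i = j then 1 else 0)"
proof -
  obtain x y p q where m: "m = (x, y, p, q)" by (metis prod.exhaust)
  define r a g where "r = sqrt y" and "a = sqrt \<alpha>" and "g = sqrt \<gamma>"
  have r: "y = r\<^sup>2" "r > 0" "a > 0" "g > 0" "sqrt (\<gamma> * y) = g * r"
    using assms by (auto simp: r_def a_def g_def m coord_domain_def real_sqrt_mult)
  define C S where "C = cos \<theta>" and "S = sin \<theta>"
  define C2 S2 where "C2 = cos (2 * \<theta>)" and "S2 = sin (2 * \<theta>)"
  have trig: "S * (S * t) = t - C * (C * t)" "S2 * (S2 * t) = t - C2 * (C2 * t)" for t
    using sin_squared_eq[of \<theta>] sin_squared_eq[of "2 * \<theta>"]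
    unfolding C_def S_def C2_def S2_def by algebra+
  show ?thesis
    using assms(4,5) r(2-4)
    by (simp add: m inv_form_def inv_frame_def r(5) C_def[symmetric] S_def[symmetric]
          C2_def[symmetric] S2_def[symmetric] r_def[symmetric] a_def[symmetric] g_def[symmetric])
      (elim disjE; simp add: r(1) divide_simps; simp add: power2_eq_square algebra_simps trig)
qed

lemma vector_4:
  fixes w x y z :: "'a::zero"
  shows "(vector [w, x, y, z] :: 'a ^ 4) $ 1 = w" "(vector [w, x, y, z] :: 'a ^ 4) $ 2 = x"
    "(vector [w, x, y, z] :: 'a ^ 4) $ 3 = y" "(vector [w, x, y, z] :: 'a ^ 4) $ 4 = z"
  by (simp_all add: vector_def)

lemma metric_matrix_xypq:
  assumes "y > 0"
  shows "metric_matrix (metric_xypq c1 c2) (x, y, p, q) =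
    vector [vector [c1 / 4 / y\<^sup>2, 0, 0, 0],
            vector [0, c1 / 4 / y\<^sup>2, 0, 0],
            vector [0, 0, c2 * ((x\<^sup>2 + y\<^sup>2) / y), c2 * (x / y)],
            vector [0, 0, c2 * (x / y), c2 / y]]"
  using assms
  by (simp add: metric_matrix_def coord_basis_def vec_eq_iff forall_4 vector_4 metric_xypq_eq)

section \<open>One-parameter subgroups and fundamental vector fields\<close>

lemma bounded_bilinear_matrix_mult: "bounded_bilinear ((**) :: real^'n^'m \<Rightarrow> real^'k^'n \<Rightarrow> real^'k^'m)"
  unfolding bilinear_conv_bounded_bilinear[symmetric] bilinear_def
  by (auto intro!: linearI simp: matrix_matrix_mult_def vec_eq_iff sum_distrib_left algebra_simps sum.distrib)

lemma bounded_bilinear_vector_matrix_mult: "bounded_bilinear ((v*) :: real^'m \<Rightarrow> real^'n^'m \<Rightarrow> real^'n)"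
  unfolding bilinear_conv_bounded_bilinear[symmetric] bilinear_def
  by (auto intro!: linearI simp: vector_matrix_mult_def vec_eq_iff sum_distrib_left algebra_simps sum.distrib)

definition heisenberg_cocycle :: "real^2 \<Rightarrow> real^2 \<Rightarrow> real" where
  "heisenberg_cocycle X Y = det (vector [X, Y] :: real^2^2)"

lemma heisenberg_cocycle_eq: "heisenberg_cocycle X Y = X $ 1 * Y $ 2 - X $ 2 * Y $ 1"
  by (simp add: heisenberg_cocycle_def det_2)

lemma heisenberg_cocycle_self: "heisenberg_cocycle X X = 0"
  by (simp add: heisenberg_cocycle_eq)

lemma bounded_bilinear_heisenberg_cocycle: "bounded_bilinear heisenberg_cocycle"
  unfolding bilinear_conv_bounded_bilinear[symmetric] bilinear_def
  by (auto intro!: linearI simp: heisenberg_cocycle_eq algebra_simps)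

text \<open>Invariance under \<open>SL(2, \<real>)\<close> is what makes the central terms cancel in the proof that
  one-parameter subgroups are unique.\<close>

lemma heisenberg_cocycle_matrix: "heisenberg_cocycle (X v* M) (Y v* M) = det M * heisenberg_cocycle X Y"
  by (simp add: heisenberg_cocycle_eq vector_matrix_mult_def sum_2 det_2 algebra_simps)

lemma real_jacobi_mult:
  "(M, X, \<kappa>) \<otimes>\<^bsub>real_jacobi\<^esub> (M', X', \<kappa>') =
    (M ** M', X v* M' + X', \<kappa> + \<kappa>' + heisenberg_cocycle (X v* M') X')"
  by (simp add: real_jacobi_def heisenberg_cocycle_def)

lemma real_jacobi_carrier: "(M, X, \<kappa>) \<in> carrier real_jacobi \<longleftrightarrow> det M = 1"
  by (simp add: real_jacobi_def)

interpretation matrix_mult: bounded_bilinear "(**) :: real^2^2 \<Rightarrow> real^2^2 \<Rightarrow> real^2^2"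
  by (rule bounded_bilinear_matrix_mult)
interpretation vector_matrix: bounded_bilinear "(v*) :: real^2 \<Rightarrow> real^2^2 \<Rightarrow> real^2"
  by (rule bounded_bilinear_vector_matrix_mult)
interpretation cocycle: bounded_bilinear heisenberg_cocycle
  by (rule bounded_bilinear_heisenberg_cocycle)

lemma real_jacobi_mult_has_vector_derivative:
  assumes "(\<phi> has_vector_derivative (M', X', k')) (at t)" "(\<psi> has_vector_derivative (N', Y', l')) (at t)"
    and "\<phi> t = (M, X, k)" "\<psi> t = (N, Y, l)"
  shows "((\<lambda>t. \<phi> t \<otimes>\<^bsub>real_jacobi\<^esub> \<psi> t) has_vector_derivative
    (M ** N' + M' ** N, X v* N' + X' v* N + Y',
     k' + l' + (heisenberg_cocycle (X v* N) Y' + heisenberg_cocycle (X v* N' + X' v* N) Y))) (at t)"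
proof -
  have split: "((\<lambda>t. fst (f t)) has_vector_derivative fst f') (at t)"
    "((\<lambda>t. snd (f t)) has_vector_derivative snd f') (at t)"
    if "(f has_vector_derivative f') (at t)" for f :: "real \<Rightarrow> 'a::real_normed_vector \<times>
        'b::real_normed_vector" and f'
    using that bounded_linear.has_vector_derivative[OF bounded_linear_fst]
      bounded_linear.has_vector_derivative[OF bounded_linear_snd] by blast+
  note f = split[OF assms(1)] split[OF split(2)[OF assms(1)]]
  note g = split[OF assms(2)] split[OF split(2)[OF assms(2)]]
  have mult: "(\<lambda>t. \<phi> t \<otimes>\<^bsub>real_jacobi\<^esub> \<psi> t) = (\<lambda>t. (fst (\<phi> t) ** fst (\<psi> t),
    fst (snd (\<phi> t)) v* fst (\<psi> t) + fst (snd (\<psi> t)),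
    snd (snd (\<phi> t)) + snd (snd (\<psi> t)) + heisenberg_cocycle (fst (snd (\<phi> t)) v* fst (\<psi> t)) (fst (snd (\<psi> t)))))"
    by (metis prod.collapse real_jacobi_mult)
  show ?thesis
    unfolding mult
    using assms(3,4)
      has_vector_derivative_Pair[OF matrix_mult.has_vector_derivative[OF f(1) g(1)]
        has_vector_derivative_Pair[OF has_vector_derivative_add[OF vector_matrix.has_vector_derivative[OF
            f(3) g(1)] g(3)]
          has_vector_derivative_add[OF has_vector_derivative_add[OF f(4) g(4)]
            cocycle.has_vector_derivative[OF vector_matrix.has_vector_derivative[OF f(3) g(1)] g(3)]]]]
    by simp
qed

lemma one_param_subgroup_zero:
  assumes "one_param_subgroup V \<phi>"
  shows "\<phi> 0 = (mat 1, 0, 0)"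
proof -
  obtain M X k where 0: "\<phi> 0 = (M, X, k)" by (metis prod.exhaust)
  have "\<phi> (0 + 0) = \<phi> 0 \<otimes>\<^bsub>real_jacobi\<^esub> \<phi> 0" "det M = 1"
    using assms 0 unfolding one_param_subgroup_def by (metis real_jacobi_carrier)+
  then have idem: "M = M ** M" "X = X v* M + X" "k = k + k + heisenberg_cocycle (X v* M) X"
    by (auto simp: 0 real_jacobi_mult)
  have "invertible M" using \<open>det M = 1\<close> by (simp add: invertible_det_nz)
  then obtain N where "N ** M = mat 1" by (auto simp: invertible_def)
  then have "M = mat 1" using idem(1)
    by (metis matrix_mul_assoc matrix_mul_lid)
  then show ?thesis using idem by (simp add: 0 vector_matrix_mul_rid heisenberg_cocycle_self)
qed

text \<open>The homomorphism property reduces derivatives at \<open>t\<close> to the one at \<open>0\<close>, through left translation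
  for \<open>\<phi>\<close> and right translation for \<open>\<psi>\<close>. The product rule then shows that \<open>\<phi>(t) \<psi>(-t)\<close> is constant, hence the
  identity.\<close>

lemma one_param_subgroup_unique:
  assumes \<phi>: "one_param_subgroup V \<phi>" and \<psi>: "one_param_subgroup V \<psi>"
  shows "\<phi> = \<psi>"
proof
  fix s
  obtain A B C where V: "V = (A, B, C)" by (metis prod.exhaust)
  have deriv: "((\<lambda>t. \<phi> t \<otimes>\<^bsub>real_jacobi\<^esub> \<psi> (- t)) has_vector_derivative 0) (at t)" for t
  proof -
    obtain M X k N Y l where eqs: "\<phi> t = (M, X, k)" "\<psi> (- t) = (N, Y, l)" by (metis prod.exhaust)
    have "det N = 1" using \<psi> eqs unfolding one_param_subgroup_def by (metis real_jacobi_carrier)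
    have 0: "(\<phi> has_vector_derivative (A, B, C)) (at (t - t))"
      "(\<psi> has_vector_derivative (A, B, C)) (at (- (t - t)))"
      using \<phi> \<psi> by (auto simp: one_param_subgroup_def V)
    have "(\<phi> \<circ> (\<lambda>u. u - t) has_vector_derivative (1 *\<^sub>R (A, B, C))) (at t)"
      by (rule vector_diff_chain_at[where f = "\<lambda>u. u - t", OF _ 0(1)]) (auto intro!: derivative_eq_intros)
    then have \<phi>0: "((\<lambda>u. \<phi> (u - t)) has_vector_derivative (A, B, C)) (at t)" by (simp add: o_def)
    have "(\<psi> \<circ> (\<lambda>u. - (u - t)) has_vector_derivative ((- 1) *\<^sub>R (A, B, C))) (at t)"
      by (rule vector_diff_chain_at[where f = "\<lambda>u. - (u - t)", OF _ 0(2)]) (auto intro!: derivative_eq_intros)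
    then have \<psi>0: "((\<lambda>u. \<psi> (- (u - t))) has_vector_derivative (- A, - B, - C)) (at t)" by (simp add: o_def)
    have \<phi>t: "\<phi> u = \<phi> t \<otimes>\<^bsub>real_jacobi\<^esub> \<phi> (u - t)" for u
      using \<phi> unfolding one_param_subgroup_def by (metis add.commute diff_add_cancel)
    have \<psi>t: "\<psi> (- u) = \<psi> (- (u - t)) \<otimes>\<^bsub>real_jacobi\<^esub> \<psi> (- t)" for u
    proof -
      have "- u = - (u - t) + (- t)" by simp
      then show ?thesis using \<psi> unfolding one_param_subgroup_def by metis
    qed
    have const: "((\<lambda>u. c) has_vector_derivative (0, 0, 0)) (at t)" for c :: jacobi_space
      using has_vector_derivative_const[of c "at t"] by (simp add: zero_prod_def)
    have "((\<lambda>u. \<phi> t \<otimes>\<^bsub>real_jacobi\<^esub> \<phi> (u - t)) has_vector_derivative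
      (M ** A, X v* A + B, C + heisenberg_cocycle X B)) (at t)"
      using real_jacobi_mult_has_vector_derivative[OF const \<phi>0 eqs(1), of "mat 1" 0 0] one_param_subgroup_zero[OF \<phi>]
      by (simp add: matrix_mult.zero_left vector_matrix.zero_left cocycle.zero_left cocycle.zero_right
          vector_matrix_mul_rid)
    then have D\<phi>: "(\<phi> has_vector_derivative (M ** A, X v* A + B, C + heisenberg_cocycle X B)) (at t)"
      by (simp only: \<phi>t[symmetric])
    have "((\<lambda>u. \<psi> (- (u - t)) \<otimes>\<^bsub>real_jacobi\<^esub> \<psi> (- t)) has_vector_derivative
      (- A ** N, - B v* N, - C - heisenberg_cocycle (B v* N) Y)) (at t)"
      using real_jacobi_mult_has_vector_derivative[OF \<psi>0 const _ eqs(2), of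
          "mat 1" 0 0] one_param_subgroup_zero[OF \<psi>]
      by (simp add: matrix_mult.zero_right vector_matrix.zero_left vector_matrix.zero_right
          cocycle.zero_left cocycle.zero_right vector_matrix.minus_left cocycle.minus_left)
    then have D\<psi>: "((\<lambda>u. \<psi> (- u)) has_vector_derivative (- A ** N, - B v* N, - C - heisenberg_cocycle (B v*
        N) Y)) (at t)"
      by (simp only: \<psi>t[symmetric])
    show ?thesis
      using real_jacobi_mult_has_vector_derivative[OF D\<phi> D\<psi> eqs] \<open>det N = 1\<close>
      by (simp add: matrix_mul_assoc matrix_mult.minus_left matrix_mult.minus_right vector_matrix.minus_left
          vector_matrix.minus_right vector_matrix.add_left
          vector_matrix_mul_assoc cocycle.minus_left cocycle.minus_right cocycle.add_left
              heisenberg_cocycle_matrix zero_prod_def)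
  qed
  \<comment> \<open>It remains to cancel: \<open>\<psi>(-s)\<close> is inverse to \<open>\<phi>(s)\<close> on one side and to \<open>\<psi>(s)\<close> on the other.\<close>
  have "\<phi> s \<otimes>\<^bsub>real_jacobi\<^esub> \<psi> (- s) = \<phi> 0 \<otimes>\<^bsub>real_jacobi\<^esub> \<psi> (- 0)"
    using has_vector_derivative_zero_constant[of UNIV "\<lambda>t. \<phi> t \<otimes>\<^bsub>real_jacobi\<^esub> \<psi> (- t)"] deriv
    by (metis UNIV_I convex_UNIV)
  then have 1: "\<phi> s \<otimes>\<^bsub>real_jacobi\<^esub> \<psi> (- s) = (mat 1, 0, 0)"
    using one_param_subgroup_zero[OF \<phi>] one_param_subgroup_zero[OF \<psi>]
    by (simp add: real_jacobi_mult vector_matrix.zero_left cocycle.zero_left)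
  have 2: "\<psi> (- s) \<otimes>\<^bsub>real_jacobi\<^esub> \<psi> s = (mat 1, 0, 0)"
    using \<psi> one_param_subgroup_zero[OF \<psi>] unfolding one_param_subgroup_def by (metis add.left_inverse)
  obtain M X k N Y l M' X' k' where eqs: "\<phi> s = (M, X, k)" "\<psi> (- s) = (N, Y, l)" "\<psi> s = (M', X', k')"
    by (metis prod.exhaust)
  have 3: "M ** N = mat 1" "X v* N + Y = 0" "k + l + heisenberg_cocycle (X v* N) Y = 0"
    "N ** M' = mat 1" "Y v* M' + X' = 0" "l + k' + heisenberg_cocycle (Y v* M') X' = 0"
    using 1 2 by (auto simp: eqs real_jacobi_mult)
  have "M = M ** (N ** M')" by (simp add: 3)
  also have "\<dots> = (M ** N) ** M'" by (simp only: matrix_mul_assoc)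
  also have "\<dots> = M'" by (simp add: 3)
  finally have M: "M = M'" .
  have "X = (X v* N) v* M'" by (simp add: vector_matrix_mul_assoc 3 vector_matrix_mul_rid)
  also have "X v* N = - Y" using 3(2) by (simp add: eq_neg_iff_add_eq_0)
  also have "- Y v* M' = X'" using 3(5) by (simp add: vector_matrix.minus_left neg_eq_iff_add_eq_0)
  finally have X: "X = X'" .
  have "X v* N = - Y" "Y v* M' = - X'" using 3(2,5) by (simp_all add: eq_neg_iff_add_eq_0)
  then have "k = k'" using 3(3,6) by (simp add: cocycle.minus_left heisenberg_cocycle_self)
  then show "\<phi> s = \<psi> s" using M X eqs by simp
qed

lemma jacobi_exp_eq:
  assumes "one_param_subgroup V \<phi>"
  shows "jacobi_exp V = \<phi> 1"
  using assms one_param_subgroup_unique the_equality[of "one_param_subgroup V" \<phi>]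
  unfolding jacobi_exp_def by metis

text \<open>The exponential series breaks off after the linear term; this covers the generators \<open>F\<close> and \<open>G\<close>.\<close>

lemma jacobi_exp_nilpotent:
  assumes "A ** A = 0" "\<And>t. det (mat 1 + t *\<^sub>R A) = 1"
  shows "jacobi_exp (t *\<^sub>R (A, 0, 0)) = (mat 1 + t *\<^sub>R A, 0, 0)"
proof -
  have "one_param_subgroup (t *\<^sub>R (A, 0, 0)) (\<lambda>s. (mat 1 + (s * t) *\<^sub>R A, 0, 0))"
    unfolding one_param_subgroup_def
  proof (intro conjI allI)
    show "(mat 1 + (s * t) *\<^sub>R A, 0, 0) \<in> carrier real_jacobi" for s
      by (simp add: real_jacobi_carrier assms(2))
    show "(mat 1 + ((s + u) * t) *\<^sub>R A, 0, 0) =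
      (mat 1 + (s * t) *\<^sub>R A, 0, 0) \<otimes>\<^bsub>real_jacobi\<^esub> (mat 1 + (u * t) *\<^sub>R A, 0, 0)" for s u
      by (simp add: real_jacobi_mult vector_matrix.zero_left cocycle.zero_left matrix_mult.add_left
          matrix_mult.add_right matrix_mult.scaleR_left matrix_mult.scaleR_right
          assms(1) algebra_simps)
    show "((\<lambda>s. (mat 1 + (s * t) *\<^sub>R A, 0, 0)) has_vector_derivative t *\<^sub>R (A, 0, 0)) (at 0)"
      by (auto simp: zero_prod_def intro!: has_vector_derivative_Pair derivative_eq_intros)
  qed
  from jacobi_exp_eq[OF this] show ?thesis by simp
qed

text \<open>The cocycle vanishes on a line, so lines through the origin of the Heisenberg group are
  one-parameter subgroups; this covers the generators \<open>P\<close>, \<open>Q\<close>, \<open>R\<close>.\<close>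

lemma jacobi_exp_heisenberg: "jacobi_exp (t *\<^sub>R (0, B, C)) = (mat 1, t *\<^sub>R B, t * C)"
proof -
  have "one_param_subgroup (t *\<^sub>R (0, B, C)) (\<lambda>s. (mat 1, (s * t) *\<^sub>R B, s * t * C))"
    unfolding one_param_subgroup_def
  proof (intro conjI allI)
    show "(mat 1, ((s + u) * t) *\<^sub>R B, (s + u) * t * C) =
      (mat 1, (s * t) *\<^sub>R B, s * t * C) \<otimes>\<^bsub>real_jacobi\<^esub> (mat 1, (u * t) *\<^sub>R B, u * t * C)" for s u
      by (simp add: real_jacobi_mult vector_matrix_mul_rid cocycle.scaleR_left cocycle.scaleR_right
          heisenberg_cocycle_self algebra_simps)
    show "((\<lambda>s. (mat 1, (s * t) *\<^sub>R B, s * t * C)) has_vector_derivative t *\<^sub>R (0, B, C)) (at 0)"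
      by (auto simp: zero_prod_def intro!: has_vector_derivative_Pair derivative_eq_intros)
  qed (simp add: real_jacobi_carrier)
  from jacobi_exp_eq[OF this] show ?thesis by simp
qed

lemma jacobi_exp_gen_H:
  "jacobi_exp (t *\<^sub>R gen_H) = (vector [vector [exp t, 0], vector [0, exp (- t)]], 0, 0)"
proof -
  \<comment> \<open>The orthogonal idempotents turn the group law into the functional equation of \<open>exp\<close>.\<close>
  define E1 E2 :: "real^2^2" where "E1 = vector [vector [1, 0], vector [0, 0]]"
    and "E2 = vector [vector [0, 0], vector [0, 1]]"
  have E: "E1 ** E1 = E1" "E2 ** E2 = E2" "E1 ** E2 = 0" "E2 ** E1 = 0"
    by (auto simp: E1_def E2_def vec_eq_iff forall_2 matrix_matrix_mult_def sum_2)
  have diag: "a *\<^sub>R E1 + b *\<^sub>R E2 = vector [vector [a, 0], vector [0, b]]" for a b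
    by (auto simp: E1_def E2_def vec_eq_iff forall_2)
  have "gen_H = (1 *\<^sub>R E1 + (- 1) *\<^sub>R E2, 0, 0)" unfolding diag gen_H_def by simp
  then have H: "gen_H = (E1 - E2, 0, 0)" by simp
  have "one_param_subgroup (t *\<^sub>R gen_H) (\<lambda>s. (exp (s * t) *\<^sub>R E1 + exp (- (s * t)) *\<^sub>R E2, 0, 0))"
    unfolding one_param_subgroup_def
  proof (intro conjI allI)
    show "(exp (s * t) *\<^sub>R E1 + exp (- (s * t)) *\<^sub>R E2, 0, 0) \<in> carrier real_jacobi" for s
      by (simp add: real_jacobi_carrier diag det_2 flip: exp_add)
    have exp: "exp ((s + u) * t) = exp (u * t) * exp (s * t)"
      "exp (- ((s + u) * t)) = exp (- (u * t)) * exp (- (s * t))" for s u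
      by (simp_all add: distrib_right flip: exp_add)
    show "(exp ((s + u) * t) *\<^sub>R E1 + exp (- ((s + u) * t)) *\<^sub>R E2, 0, 0) =
      (exp (s * t) *\<^sub>R E1 + exp (- (s * t)) *\<^sub>R E2, 0, 0) \<otimes>\<^bsub>real_jacobi\<^esub>
      (exp (u * t) *\<^sub>R E1 + exp (- (u * t)) *\<^sub>R E2, 0, 0)" for s u
      unfolding exp by (simp add: real_jacobi_mult vector_matrix.zero_left cocycle.zero_left
          matrix_mult.add_left matrix_mult.add_right
          matrix_mult.scaleR_left matrix_mult.scaleR_right E)
    show "((\<lambda>s. (exp (s * t) *\<^sub>R E1 + exp (- (s * t)) *\<^sub>R E2, 0, 0)) has_vector_derivative t *\<^sub>R gen_H) (at 0)"
      unfolding H by (auto simp: zero_prod_def algebra_simps intro!: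
          has_vector_derivative_Pair derivative_eq_intros)
  qed
  from jacobi_exp_eq[OF this] show ?thesis by (simp add: diag)
qed

lemma jacobi_exp_gen_F: "jacobi_exp (t *\<^sub>R gen_F) = (vector [vector [1, t], vector [0, 1]], 0, 0)"
  unfolding gen_F_def
  by (subst jacobi_exp_nilpotent)
    (auto simp: vec_eq_iff forall_2 matrix_matrix_mult_def sum_2 det_2 mat_def)

lemma jacobi_exp_gen_G: "jacobi_exp (t *\<^sub>R gen_G) = (vector [vector [1, 0], vector [t, 1]], 0, 0)"
  unfolding gen_G_def
  by (subst jacobi_exp_nilpotent)
    (auto simp: vec_eq_iff forall_2 matrix_matrix_mult_def sum_2 det_2 mat_def)

lemma fundamental_field_eqI:
  assumes "\<And>t. jacobi_act (jacobi_proj (jacobi_exp (t *\<^sub>R V))) m = \<phi> t"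
    and "(\<phi> has_vector_derivative D) (at 0)"
  shows "fundamental_field V m = D"
  using assms by (simp add: fundamental_field_def vector_derivative_at)

lemma fundamental_field_gen_F: "fundamental_field gen_F (\<tau>, z) = (1, 0)"
  by (rule fundamental_field_eqI[where \<phi> = "\<lambda>t. (\<tau> + of_real t, z)"])
    (auto simp: jacobi_exp_gen_F jacobi_proj_def jacobi_act_def
      intro!: has_vector_derivative_Pair derivative_eq_intros has_vector_derivative_of_real)

lemma fundamental_field_gen_G: "fundamental_field gen_G (\<tau>, z) = (- \<tau>\<^sup>2, - z * \<tau>)"
proof (rule fundamental_field_eqI[where \<phi> = "\<lambda>t. (\<tau> / (of_real t * \<tau> + 1), z / (of_real t * \<tau> + 1))"])
  have D: "((\<lambda>t. w / (complex_of_real t * \<tau> + 1)) has_vector_derivative - w * \<tau>) (at 0)" for w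
    unfolding has_vector_derivative_def
    by (auto intro!: derivative_eq_intros simp: scaleR_conv_of_real mult_ac)
  show "((\<lambda>t. (\<tau> / (of_real t * \<tau> + 1), z / (of_real t * \<tau> + 1))) has_vector_derivative (- \<tau>\<^sup>2, - z * \<tau>)) (at 0)"
    using has_vector_derivative_Pair[OF D[of \<tau>] D[of z]] by (simp add: power2_eq_square)
qed (simp add: jacobi_exp_gen_G jacobi_proj_def jacobi_act_def Let_def)

lemma fundamental_field_gen_H: "fundamental_field gen_H (\<tau>, z) = (2 * \<tau>, z)"
proof (rule fundamental_field_eqI[where \<phi> = "\<lambda>t. (exp (2 * t) *\<^sub>R \<tau>, exp t *\<^sub>R z)"])
  show "((\<lambda>t. (exp (2 * t) *\<^sub>R \<tau>, exp t *\<^sub>R z)) has_vector_derivative (2 * \<tau>, z)) (at 0)"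
    unfolding has_vector_derivative_def
    by (auto intro!: derivative_eq_intros simp: scaleR_conv_of_real)
  have "exp (2 * t) = exp t * exp t" for t :: real by (simp flip: exp_add)
  then show "jacobi_act (jacobi_proj (jacobi_exp (t *\<^sub>R gen_H))) (\<tau>, z) = (exp (2 * t) *\<^sub>R \<tau>, exp t *\<^sub>R z)" for t
    by (simp add: jacobi_exp_gen_H jacobi_proj_def jacobi_act_def exp_minus scaleR_conv_of_real divide_inverse
        flip: of_real_inverse)
qed

lemma fundamental_field_heisenberg:
  "fundamental_field (0, B, C) (\<tau>, z) = (0, complex_of_real (B $ 1) * \<tau> + complex_of_real (B $ 2))"
proof (rule fundamental_field_eqI[where \<phi> = "\<lambda>t. (\<tau>, z + t *\<^sub>R (complex_of_real (B $ 1) * \<tau>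
    + complex_of_real (B $ 2)))"])
  show "((\<lambda>t. (\<tau>, z + t *\<^sub>R (complex_of_real (B $ 1) * \<tau> + complex_of_real (B $ 2)))) has_vector_derivative
      (0, complex_of_real (B $ 1) * \<tau> + complex_of_real (B $ 2))) (at 0)"
    by (auto intro!: has_vector_derivative_Pair derivative_eq_intros)
  show "jacobi_act (jacobi_proj (jacobi_exp (t *\<^sub>R (0, B, C)))) (\<tau>, z) =
    (\<tau>, z + t *\<^sub>R (complex_of_real (B $ 1) * \<tau> + complex_of_real (B $ 2)))" for t
    unfolding jacobi_exp_heisenberg
    by (simp add: jacobi_proj_def jacobi_act_def Let_def mat_def complex_eq_iff) (simp add: algebra_simps)
qed

lemma to_xypq_has_derivative:
  assumes "y > 0"
  shows "(to_xypq has_derivative (\<lambda>(d\<tau>, dz). let dp = (Im dz - p * Im d\<tau>) / y in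
     (Re d\<tau>, Im d\<tau>, dp, Re dz - dp * x - p * Re d\<tau>))) (at (from_xypq (x, y, p, q)))"
proof -
  have eq: "to_xypq = (\<lambda>m. (Re (fst m), Im (fst m), Im (snd m) / Im (fst m),
      Re (snd m) - Im (snd m) / Im (fst m) * Re (fst m)))"
    by (auto simp: to_xypq_def fun_eq_iff)
  show ?thesis
    unfolding eq using assms
    by (auto intro!: derivative_eq_intros ext simp: from_xypq_def Let_def)
     (simp_all add: field_simps)
qed

lemma fundamental_xypq_eq:
  assumes "y > 0"
  shows "fundamental_xypq gen_F (x, y, p, q) = (1, 0, 0, - p)"
    and "fundamental_xypq gen_G (x, y, p, q) = (y\<^sup>2 - x\<^sup>2, - 2 * x * y, - q, 0)"
    and "fundamental_xypq gen_H (x, y, p, q) = (2 * x, 2 * y, - p, q)"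
    and "fundamental_xypq gen_P (x, y, p, q) = (0, 0, 1, 0)"
    and "fundamental_xypq gen_Q (x, y, p, q) = (0, 0, 0, 1)"
    and "fundamental_xypq gen_R (x, y, p, q) = (0, 0, 0, 0)"
proof -
  have square: "Re ((Complex x y)\<^sup>2) = x\<^sup>2 - y\<^sup>2" "Im ((Complex x y)\<^sup>2) = 2 * x * y"
    by (simp_all add: power2_eq_square)
  have numerator: "(- (p * x) - q) * y - p * y * x + p * (2 * x * y) = - q * y" by algebra
  show "fundamental_xypq gen_F (x, y, p, q) = (1, 0, 0, - p)"
    and "fundamental_xypq gen_G (x, y, p, q) = (y\<^sup>2 - x\<^sup>2, - 2 * x * y, - q, 0)"
    and "fundamental_xypq gen_H (x, y, p, q) = (2 * x, 2 * y, - p, q)"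
    and "fundamental_xypq gen_P (x, y, p, q) = (0, 0, 1, 0)"
    and "fundamental_xypq gen_Q (x, y, p, q) = (0, 0, 0, 1)"
    and "fundamental_xypq gen_R (x, y, p, q) = (0, 0, 0, 0)"
  unfolding fundamental_xypq_def frechet_derivative_at[OF to_xypq_has_derivative[OF assms], symmetric]
  using assms
  by (simp_all add: from_xypq_def fundamental_field_gen_F fundamental_field_gen_G fundamental_field_gen_H
      gen_P_def gen_Q_def gen_R_def fundamental_field_heisenberg Let_def square numerator)
    (simp add: power2_eq_square algebra_simps)
qed

section \<open>Partial derivatives on the coordinate domain\<close>

lemma smooth_on_pd:
  assumes "smooth_on S f"
  shows "smooth_on S (pdx f)" "smooth_on S (pdy f)" "smooth_on S (pdp f)" "smooth_on S (pdq f)"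
  using smooth_on_frechet_derivative[OF assms]
  by (simp_all add: pdx_def[abs_def] pdy_def[abs_def] pdp_def[abs_def] pdq_def[abs_def])

text \<open>The next two lemmas translate between partial derivatives and ordinary derivatives along
  coordinate lines, so that identities between functions can be differentiated by calculus in one
  variable.\<close>

lemma pd_has_field_derivative:
  assumes "smooth_on coord_domain f" and "y > 0"
  shows "((\<lambda>t. f (t, y, p, q)) has_field_derivative pdx f (x, y, p, q)) (at x)"
    and "((\<lambda>t. f (x, t, p, q)) has_field_derivative pdy f (x, y, p, q)) (at y)"
    and "((\<lambda>t. f (x, y, t, q)) has_field_derivative pdp f (x, y, p, q)) (at p)"
    and "((\<lambda>t. f (x, y, p, t)) has_field_derivative pdq f (x, y, p, q)) (at q)"
  using smooth_on_DERIV_line[OF assms(1), of "(0, y, p, q)" x "(1, 0, 0, 0)"]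
    smooth_on_DERIV_line[OF assms(1), of "(x, 0, p, q)" y "(0, 1, 0, 0)"]
    smooth_on_DERIV_line[OF assms(1), of "(x, y, 0, q)" p "(0, 0, 1, 0)"]
    smooth_on_DERIV_line[OF assms(1), of "(x, y, p, 0)" q "(0, 0, 0, 1)"] assms(2)
  by (simp_all add: coord_domain_def pdx_def pdy_def pdp_def pdq_def)

lemma pd_eqI:
  assumes "smooth_on coord_domain f" and "y > 0"
  shows "(\<And>t. f (t, y, p, q) = F t) \<Longrightarrow> (F has_field_derivative D) (at x) \<Longrightarrow> pdx f (x, y, p, q) = D"
    and "(\<And>t. t > 0 \<Longrightarrow> f (x, t, p, q) = F t) \<Longrightarrow> (F has_field_derivative D) (at y) \<Longrightarrow> pdy f (x, y, p, q) = D"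
    and "(\<And>t. f (x, y, t, q) = F t) \<Longrightarrow> (F has_field_derivative D) (at p) \<Longrightarrow> pdp f (x, y, p, q) = D"
    and "(\<And>t. f (x, y, p, t) = F t) \<Longrightarrow> (F has_field_derivative D) (at q) \<Longrightarrow> pdq f (x, y, p, q) = D"
proof -
  note D = pd_has_field_derivative[OF assms]
  show "(\<And>t. f (t, y, p, q) = F t) \<Longrightarrow> (F has_field_derivative D) (at x) \<Longrightarrow> pdx f (x, y, p, q) = D"
    using DERIV_unique[OF D(1)] by simp
  show "(\<And>t. f (x, y, t, q) = F t) \<Longrightarrow> (F has_field_derivative D) (at p) \<Longrightarrow> pdp f (x, y, p, q) = D"
    using DERIV_unique[OF D(3)] by simp
  show "(\<And>t. f (x, y, p, t) = F t) \<Longrightarrow> (F has_field_derivative D) (at q) \<Longrightarrow> pdq f (x, y, p, q) = D"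
    using DERIV_unique[OF D(4)] by simp
  show "pdy f (x, y, p, q) = D" if F: "\<And>t. t > 0 \<Longrightarrow> f (x, t, p, q) = F t" "(F has_field_derivative D) (at y)"
  proof -
    have "((\<lambda>t. f (x, t, p, q)) has_field_derivative D) (at y)"
      by (rule has_field_derivative_transform_within_open[OF F(2), of "{0<..}"]) (use F(1) assms(2) in auto)
    then show ?thesis by (rule DERIV_unique[OF D(2)])
  qed
qed

lemma pd_commute:
  assumes "smooth_on coord_domain f" and "y > 0"
  shows "pdy (pdx f) (x, y, p, q) = pdx (pdy f) (x, y, p, q)"
    and "pdp (pdx f) (x, y, p, q) = pdx (pdp f) (x, y, p, q)"
    and "pdq (pdx f) (x, y, p, q) = pdx (pdq f) (x, y, p, q)"
    and "pdp (pdy f) (x, y, p, q) = pdy (pdp f) (x, y, p, q)"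
    and "pdq (pdy f) (x, y, p, q) = pdy (pdq f) (x, y, p, q)"
    and "pdq (pdp f) (x, y, p, q) = pdp (pdq f) (x, y, p, q)"
proof -
  have "(x, y, p, q) \<in> coord_domain" using assms(2) by (simp add: coord_domain_def)
  note c = frechet_derivative_commute[OF open_coord_domain this assms(1)]
  show "pdy (pdx f) (x, y, p, q) = pdx (pdy f) (x, y, p, q)"
    "pdp (pdx f) (x, y, p, q) = pdx (pdp f) (x, y, p, q)"
    "pdq (pdx f) (x, y, p, q) = pdx (pdq f) (x, y, p, q)"
    "pdp (pdy f) (x, y, p, q) = pdy (pdp f) (x, y, p, q)"
    "pdq (pdy f) (x, y, p, q) = pdy (pdq f) (x, y, p, q)"
    "pdq (pdp f) (x, y, p, q) = pdp (pdq f) (x, y, p, q)"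
    unfolding pdx_def[abs_def] pdy_def[abs_def] pdp_def[abs_def] pdq_def[abs_def] by (rule c)+
qed

lemma smooth_on_coords:
  "smooth_on coord_domain (\<lambda>m::real4. fst m)" "smooth_on coord_domain (\<lambda>m::real4. fst (snd m))"
  "smooth_on coord_domain (\<lambda>m::real4. fst (snd (snd m)))" "smooth_on coord_domain (\<lambda>m::real4. snd (snd (snd m)))"
proof -
  have s: "smooth_on coord_domain (\<lambda>m::real4. m)"
    by (rule smooth_on_bounded_linear) (rule bounded_linear_ident)
  note l = smooth_on_linear_compose[OF open_coord_domain]
  note f = l[OF bounded_linear_fst] and g = l[OF bounded_linear_snd]
  show "smooth_on coord_domain (\<lambda>m::real4. fst m)" "smooth_on coord_domain (\<lambda>m::real4. fst (snd m))"
    "smooth_on coord_domain (\<lambda>m::real4. fst (snd (snd m)))" "smooth_on coord_domain (\<lambda>m::real4. snd (snd (snd m)))"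
    using f[OF s] f[OF g[OF s]] f[OF g[OF g[OF s]]] g[OF g[OF g[OF s]]] by simp_all
qed

lemmas smooth_intros = smooth_on_coords smooth_on_const smooth_on_add smooth_on_diff smooth_on_mult
  smooth_on_uminus smooth_on_divide smooth_on_power open_coord_domain

text \<open>Functions that depend on the fibre coordinates \<open>(p, q)\<close> only. They are kept as functions of all four
  coordinates so that the symmetry of second derivatives applies to them; the base point \<open>(0, 1)\<close> serves
  as the normal form of their arguments.\<close>

definition fibre_function :: "(real4 \<Rightarrow> real) \<Rightarrow> bool" where
  "fibre_function f \<longleftrightarrow> smooth_on coord_domain f \<and>
     (\<forall>x y p q. y > 0 \<longrightarrow> pdx f (x, y, p, q) = 0 \<and> pdy f (x, y, p, q) = 0)"

lemma fibre_function_smooth: "fibre_function f \<Longrightarrow> smooth_on coord_domain f"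
  by (simp add: fibre_function_def)

lemma fibre_function_const:
  assumes f: "fibre_function f" and "y > 0"
  shows "f (x, y, p, q) = f (0, 1, p, q)"
proof -
  have "((\<lambda>t. f (t, y, p, q)) has_field_derivative 0) (at t)" for t
    using pd_has_field_derivative(1)[OF fibre_function_smooth[OF f] assms(2), of p q t] f assms(2)
    by (simp add: fibre_function_def)
  then have 1: "f (x, y, p, q) = f (0, y, p, q)"
    using DERIV_isconst_all[of "\<lambda>t. f (t, y, p, q)"] by blast
  have "((\<lambda>t. f (0, t, p, q)) has_field_derivative 0) (at t within {0<..})" if "t \<in> {0<..}" for t
    using pd_has_field_derivative(2)[OF fibre_function_smooth[OF f], of t 0 p q] f that
    by (auto simp: fibre_function_def intro: has_field_derivative_at_within)
  then have "\<exists>c. \<forall>t\<in>{0<..}. f (0, t, p, q) = c"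
    by (intro has_field_derivative_zero_constant) auto
  then have "f (0, y, p, q) = f (0, 1, p, q)" using assms(2) by fastforce
  with 1 show ?thesis by simp
qed

lemma fibre_function_pd:
  assumes f: "fibre_function f"
  shows "fibre_function (pdp f)" "fibre_function (pdq f)"
proof -
  note s = fibre_function_smooth[OF f]
  have "pdx (pdp f) (x, y, p, q) = 0" "pdy (pdp f) (x, y, p, q) = 0"
    "pdx (pdq f) (x, y, p, q) = 0" "pdy (pdq f) (x, y, p, q) = 0" if "y > 0" for x y p q
    using pd_commute(2-5)[OF s that, of x p q, symmetric] f that
      pd_eqI(3)[OF smooth_on_pd(1)[OF s] that, of x q "\<lambda>_. 0" 0 p]
      pd_eqI(3)[OF smooth_on_pd(2)[OF s] that, of x q "\<lambda>_. 0" 0 p]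
      pd_eqI(4)[OF smooth_on_pd(1)[OF s] that, of x p "\<lambda>_. 0" 0 q]
      pd_eqI(4)[OF smooth_on_pd(2)[OF s] that, of x p "\<lambda>_. 0" 0 q]
    by (simp_all add: fibre_function_def)
  then show "fibre_function (pdp f)" "fibre_function (pdq f)"
    using smooth_on_pd[OF s] by (auto simp: fibre_function_def)
qed

lemma fibre_function_constant:
  assumes f: "fibre_function f" and "\<And>p q. pdp f (0, 1, p, q) = 0" "\<And>p q. pdq f (0, 1, p, q) = 0"
    and "y > 0"
  shows "f (x, y, p, q) = f (0, 1, 0, 0)"
proof -
  have "((\<lambda>t. f (0, 1, t, q)) has_field_derivative 0) (at t)" for t
    using pd_has_field_derivative(3)[OF fibre_function_smooth[OF f], of 1 0 q t] assms(2) by simp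
  then have 1: "f (0, 1, p, q) = f (0, 1, 0, q)"
    using DERIV_isconst_all[of "\<lambda>t. f (0, 1, t, q)"] by blast
  have "((\<lambda>t. f (0, 1, 0, t)) has_field_derivative 0) (at t)" for t
    using pd_has_field_derivative(4)[OF fibre_function_smooth[OF f], of 1 0 0 t] assms(3) by simp
  then have "f (0, 1, 0, q) = f (0, 1, 0, 0)"
    using DERIV_isconst_all[of "\<lambda>t. f (0, 1, 0, t)"] by blast
  with 1 show ?thesis using fibre_function_const[OF f assms(4)] by simp
qed

section \<open>The Killing equations as components of the Lie derivative\<close>

lemma metric_xypq_has_derivative:
  fixes x y p q c1 c2 :: real
  assumes "y > 0"
  defines "r \<equiv> inverse y"
  shows "((\<lambda>m. metric_xypq c1 c2 m (v1, v2, v3, v4) (w1, w2, w3, w4)) has_derivative (\<lambda>(dx, dy, dp, dq).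
    - (c1 / 2) * (v1 * w1 + v2 * w2) * dy * r ^ 3
    + c2 * (((2 * x * dx + 2 * y * dy) * r - (x\<^sup>2 + y\<^sup>2) * dy * r\<^sup>2) * (v3 * w3)
      - dy * r\<^sup>2 * (v4 * w4) + (dx * r - x * dy * r\<^sup>2) * (v3 * w4 + v4 * w3)))) (at (x, y, p, q))"
proof -
  have m: "(x, y, p, q) \<in> coord_domain" using assms by (simp add: coord_domain_def)
  define G where "G m = c1 / 4 * (v1 * w1 + v2 * w2) * (inverse (fst (snd m)))\<^sup>2
    + c2 * (((fst m)\<^sup>2 + (fst (snd m))\<^sup>2) * (v3 * w3) + v4 * w4 + fst m * (v3 * w4 + v4 * w3)) *
      inverse (fst (snd m))" for m :: real4
  have G: "G m = metric_xypq c1 c2 m (v1, v2, v3, v4) (w1, w2, w3, w4)" if "m \<in> coord_domain" for m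
    using that by (cases m) (auto simp: G_def coord_domain_def metric_xypq_eq field_simps)
  have "(G has_derivative (\<lambda>(dx, dy, dp, dq).
    - (c1 / 2) * (v1 * w1 + v2 * w2) * dy * r ^ 3
    + c2 * (((2 * x * dx + 2 * y * dy) * r - (x\<^sup>2 + y\<^sup>2) * dy * r\<^sup>2) * (v3 * w3)
      - dy * r\<^sup>2 * (v4 * w4) + (dx * r - x * dy * r\<^sup>2) * (v3 * w4 + v4 * w3)))) (at (x, y, p, q))"
    unfolding G_def[abs_def] using assms(1)
    by (auto intro!: derivative_eq_intros ext simp: r_def[symmetric])
      (simp add: algebra_simps power2_eq_square power3_eq_cube)
  from has_derivative_transform_within_open[OF this open_coord_domain m G] show ?thesis .
qed

text \<open>The Lie derivative is a symmetric bilinear form in the two tangent vectors; its coefficients are, up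
  to powers of \<open>y\<close> and the constants, the left-hand sides of the Killing equations.\<close>

lemma lie_derivative_metric_xypq:
  fixes X :: "real4 \<Rightarrow> real4" and x y p q c1 c2 :: real
  assumes X: "smooth_on coord_domain X" and y: "y > 0"
  defines "r \<equiv> inverse y" and "m \<equiv> (x, y, p, q)"
    and "X1 \<equiv> \<lambda>m. fst (X m)" and "X2 \<equiv> \<lambda>m. fst (snd (X m))"
    and "X3 \<equiv> \<lambda>m. fst (snd (snd (X m)))" and "X4 \<equiv> \<lambda>m. snd (snd (snd (X m)))"
  shows "lie_derivative X (metric_xypq c1 c2) m (v1, v2, v3, v4) (w1, w2, w3, w4) =
    (v1 * w1) * (c1 / 2 * r ^ 3 * (- X2 m + y * pdx X1 m))
    + (v1 * w2 + v2 * w1) * (c1 / 4 * r\<^sup>2 * (pdx X2 m + pdy X1 m))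
    + (v1 * w3 + v3 * w1) * (r * (c2 * ((x\<^sup>2 + y\<^sup>2) * pdx X3 m + x * pdx X4 m) + c1 / (4 * y) * pdp X1 m))
    + (v1 * w4 + v4 * w1) * (r * (c1 / (4 * y) * pdq X1 m + c2 * (x * pdx X3 m + pdx X4 m)))
    + (v2 * w2) * (c1 / 2 * r ^ 3 * (- X2 m + y * pdy X2 m))
    + (v2 * w3 + v3 * w2) * (r * (c2 * ((x\<^sup>2 + y\<^sup>2) * pdy X3 m + x * pdy X4 m) + c1 / (4 * y) * pdp X2 m))
    + (v2 * w4 + v4 * w2) * (r * (c2 * (x * pdy X3 m + pdy X4 m) + c1 / (4 * y) * pdq X2 m))
    + (v3 * w3) * (c2 * r\<^sup>2 * (2 * x * y * X1 m + (- x\<^sup>2 + y\<^sup>2) * X2 m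
          + 2 * y * (x\<^sup>2 + y\<^sup>2) * pdp X3 m + 2 * x * y * pdp X4 m))
    + (v3 * w4 + v4 * w3) * (c2 * r\<^sup>2 * (y * X1 m - x * X2 m + x * y * pdp X3 m + y * pdp X4 m
          + y * (x\<^sup>2 + y\<^sup>2) * pdq X3 m + x * y * pdq X4 m))
    + (v4 * w4) * (c2 * r\<^sup>2 * (- X2 m + 2 * x * y * pdq X3 m + 2 * y * pdq X4 m))"
proof -
  have m: "m \<in> coord_domain" using y by (simp add: m_def coord_domain_def)
  define D where "D = frechet_derivative X (at m)"
  have DX: "(X has_derivative D) (at m)" unfolding D_def by (rule smooth_on_has_derivative[OF X m])
  interpret D: linear D using DX has_derivative_linear by blast
  have comp: "frechet_derivative X1 (at m) v = fst (D v)" "frechet_derivative X2 (at m) v = fst (snd (D v))"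
    "frechet_derivative X3 (at m) v = fst (snd (snd (D v)))" "frechet_derivative X4 (at m) v
        = snd (snd (snd (D v)))" for v
    unfolding X1_def X2_def X3_def X4_def
    using frechet_derivative_at[OF has_derivative_fst[OF DX]]
      frechet_derivative_at[OF has_derivative_fst[OF has_derivative_snd[OF DX]]]
      frechet_derivative_at[OF has_derivative_fst[OF has_derivative_snd[OF has_derivative_snd[OF DX]]]]
      frechet_derivative_at[OF has_derivative_snd[OF has_derivative_snd[OF has_derivative_snd[OF DX]]]]
    by metis+
  have D: "D (v1, v2, v3, v4) =
    (v1 * pdx X1 m + v2 * pdy X1 m + v3 * pdp X1 m + v4 * pdq X1 m,
     v1 * pdx X2 m + v2 * pdy X2 m + v3 * pdp X2 m + v4 * pdq X2 m,
     v1 * pdx X3 m + v2 * pdy X3 m + v3 * pdp X3 m + v4 * pdq X3 m,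
     v1 * pdx X4 m + v2 * pdy X4 m + v3 * pdp X4 m + v4 * pdq X4 m)" for v1 v2 v3 v4
  proof -
    have "(v1, v2, v3, v4) = v1 *\<^sub>R (1, 0, 0, 0) + v2 *\<^sub>R (0, 1, 0, 0) + v3 *\<^sub>R (0, 0, 1, 0)
        + v4 *\<^sub>R ((0, 0, 0, 1)::real4)"
      by simp
    then have "D (v1, v2, v3, v4) = v1 *\<^sub>R D (1, 0, 0, 0) + v2 *\<^sub>R D (0, 1, 0, 0) + v3 *\<^sub>R D (0, 0, 1, 0)
        + v4 *\<^sub>R D (0, 0, 0, 1)"
      by (simp only: D.add D.scaleR)
    then show ?thesis
      by (simp add: prod_eq_iff pdx_def pdy_def pdp_def pdq_def comp)
  qed
  have Xm: "X m = (X1 m, X2 m, X3 m, X4 m)" by (simp add: X1_def X2_def X3_def X4_def)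
  have metric: "metric_xypq c1 c2 m (v1, v2, v3, v4) (w1, w2, w3, w4) = c1 / 4 * r\<^sup>2 * (v1 * w1 + v2 * w2)
    + c2 * r * ((x\<^sup>2 + y\<^sup>2) * v3 * w3 + v4 * w4 + x * (v3 * w4 + v4 * w3))" for v1 v2 v3 v4 w1 w2 w3 w4
    using y by (simp add: m_def metric_xypq_eq r_def field_simps)
  have ry: "r * y = 1" using y by (simp add: r_def)
  have div: "c1 / (4 * y) = c1 / 4 * r" by (simp add: r_def field_simps)
  have cancel: "r ^ 3 * y = r\<^sup>2" "r\<^sup>2 * y = r" "r\<^sup>2 * y\<^sup>2 = 1" using ry by algebra+
  \<comment> \<open>Once \<open>y\<close> has been cancelled against \<open>r\<close> in each coefficient, both sides are polynomials and agree
    identically.\<close>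
  have ab: "c1 / 2 * r ^ 3 * (- A + y * B) = c1 / 2 * (r\<^sup>2 * B - r ^ 3 * A)" for A B
    using cancel(1) by algebra
  have pp: "c2 * r\<^sup>2 * (2 * x * y * A + (- x\<^sup>2 + y\<^sup>2) * B + 2 * y * (x\<^sup>2 + y\<^sup>2) * C + 2 * x * y * E) =
    c2 * ((2 * x * A + 2 * y * B) * r - (x\<^sup>2 + y\<^sup>2) * B * r\<^sup>2 + 2 * r * ((x\<^sup>2 + y\<^sup>2) * C + x * E))" for A B C E
    using ry by algebra
  have pq: "c2 * r\<^sup>2 * (y * A - x * B + x * y * C + y * E + y * (x\<^sup>2 + y\<^sup>2) * F + x * y * G) =
    c2 * (r * A - r\<^sup>2 * x * B + r * (x * C + E + (x\<^sup>2 + y\<^sup>2) * F + x * G))" for A B C E F G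
    using ry by algebra
  have qq: "c2 * r\<^sup>2 * (- A + 2 * x * y * B + 2 * y * C) = c2 * (- r\<^sup>2 * A + 2 * r * (x * B + C))" for A B C
    using ry by algebra
  show ?thesis
    unfolding lie_derivative_def frechet_derivative_at[OF metric_xypq_has_derivative[OF y, where x = x and p
        = p and q = q], folded m_def, symmetric]
      D_def[symmetric] D Xm prod.case metric div r_def[symmetric] ab pp pq qq
    by (simp add: algebra_simps add_divide_distrib power2_eq_square power3_eq_cube)
qed

lemma symmetric_form_eq_zero_iff:
  fixes e1 e2 e3 e4 e5 e6 e7 e8 e9 e10 :: real
  shows "(\<forall>v1 v2 v3 v4 w1 w2 w3 w4. v1 * w1 * e1 + (v1 * w2 + v2 * w1) * e2 + (v1 * w3 + v3 * w1) * e3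
      + (v1 * w4 + v4 * w1) * e4 + v2 * w2 * e5 + (v2 * w3 + v3 * w2) * e6 + (v2 * w4 + v4 * w2) * e7
      + v3 * w3 * e8 + (v3 * w4 + v4 * w3) * e9 + v4 * w4 * e10 = 0) \<longleftrightarrow>
    e1 = 0 \<and> e2 = 0 \<and> e3 = 0 \<and> e4 = 0 \<and> e5 = 0 \<and> e6 = 0 \<and> e7 = 0 \<and> e8 = 0 \<and> e9 = 0 \<and> e10 = 0"
    (is "?L \<longleftrightarrow> ?R")
proof
  assume ?L
  note L = this[rule_format]
  show ?R
    using L[of 1 1 0 0 0 0 0 0] L[of 1 0 1 0 0 0 0 0] L[of 1 0 0 0 1 0 0 0] L[of 1 0 0 0 0 0 1 0]
      L[of 0 0 1 1 0 0 0 0] L[of 0 0 0 1 1 0 0 0] L[of 0 0 0 1 0 0 1 0] L[of 0 0 0 0 1 1 0 0]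
      L[of 0 0 0 0 0 1 1 0] L[of 0 0 0 0 0 0 1 1]
    by simp
qed simp

lemma killing_on_iff_killing_equations:
  assumes c: "c1 > 0" "c2 > 0" and X: "smooth_on coord_domain X"
  shows "killing_on coord_domain (metric_xypq c1 c2) X \<longleftrightarrow> killing_equations c1 c2 X"
proof -
  have factors: "c1 / 2 * inverse y ^ 3 \<noteq> 0" "c1 / 4 * (inverse y)\<^sup>2 \<noteq> 0" "inverse y \<noteq> 0"
    "c2 * (inverse y)\<^sup>2 \<noteq> 0" if "y > 0" for y
    using that c by auto
  have scale: "(k * e = 0) = (e = 0)" if "k \<noteq> 0" for k e :: real using that by simp
  have "killing_on coord_domain (metric_xypq c1 c2) X \<longleftrightarrow> (\<forall>x y p q. y > 0 \<longrightarrow> (\<forall>v1 v2 v3 v4 w1 w2 w3 w4.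
    lie_derivative X (metric_xypq c1 c2) (x, y, p, q) (v1, v2, v3, v4) (w1, w2, w3, w4) = 0))"
    using X by (simp add: killing_on_def Ball_def coord_domain_def)
  also have "\<dots> \<longleftrightarrow> killing_equations c1 c2 X"
    unfolding killing_equations_def Let_def
    by (intro all_cong1 imp_cong refl,
        simp only: lie_derivative_metric_xypq[OF X] symmetric_form_eq_zero_iff scale[OF factors(1)]
          scale[OF factors(2)] scale[OF factors(3)] scale[OF factors(4)])
  finally show ?thesis .
qed

section \<open>Solving the Killing equations\<close>

text \<open>These are the Killing equations of the hyperbolic plane, with \<open>(p, q)\<close> as parameters. The
  coefficients are recovered from the field as \<open>B = V\<^sub>x / (2 y)\<close>, \<open>A = V / y - 2 x B\<close> and
  \<open>E = U - B (x\<^sup>2 - y\<^sup>2) - A x\<close>; that they do not depend on \<open>(x, y)\<close> follows from \<open>V\<^sub>x\<^sub>x = 0\<close> and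
  \<open>V\<^sub>x\<^sub>y = V\<^sub>x / y\<close>.\<close>

lemma half_plane_killing_field:
  assumes U: "smooth_on coord_domain U" and V: "smooth_on coord_domain V"
    and Ux: "\<And>x y p q. y > 0 \<Longrightarrow> pdx U (x, y, p, q) = V (x, y, p, q) / y"
    and Vy: "\<And>x y p q. y > 0 \<Longrightarrow> pdy V (x, y, p, q) = V (x, y, p, q) / y"
    and Uy: "\<And>x y p q. y > 0 \<Longrightarrow> pdy U (x, y, p, q) = - pdx V (x, y, p, q)"
  obtains A B E where "fibre_function A" "fibre_function B" "fibre_function E"
    "\<And>x y p q. y > 0 \<Longrightarrow> V (x, y, p, q) = y * (A (x, y, p, q) + 2 * x * B (x, y, p, q))"
    "\<And>x y p q. y > 0 \<Longrightarrow> U (x, y, p, q) =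
      B (x, y, p, q) * (x\<^sup>2 - y\<^sup>2) + A (x, y, p, q) * x + E (x, y, p, q)"
proof -
  note D = pd_has_field_derivative
  have Vxy: "pdy (pdx V) (x, y, p, q) = pdx V (x, y, p, q) / y" if "y > 0" for x y p q
    unfolding pd_commute(1)[OF V that]
    by (rule pd_eqI(1)[OF smooth_on_pd(2)[OF V] that Vy[OF that]]) (rule DERIV_cdivide[OF D(1)[OF V that]])
  have Uxy: "pdy (pdx U) (x, y, p, q) = 0" if "y > 0" for x y p q
    by (rule pd_eqI(2)[OF smooth_on_pd(1)[OF U] that Ux])
      (use that in \<open>auto intro!: derivative_eq_intros D(2)[OF V that] simp: Vy\<close>)
  have Vxx: "pdx (pdx V) (x, y, p, q) = 0" if "y > 0" for x y p q
  proof (rule pd_eqI(1)[OF smooth_on_pd(1)[OF V] that])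
    show "pdx V (t, y, p, q) = - pdy U (t, y, p, q)" for t using Uy[OF that] by simp
    show "((\<lambda>t. - pdy U (t, y, p, q)) has_field_derivative 0) (at x)"
      using DERIV_minus[OF D(1)[OF smooth_on_pd(2)[OF U] that]] Uxy[OF that] pd_commute(1)[OF U that] by simp
  qed
  define B where "B = (\<lambda>m. pdx V m / (2 * fst (snd m)))"
  define A where "A = (\<lambda>m. V m / fst (snd m) - 2 * fst m * B m)"
  define E where "E = (\<lambda>m. U m - B m * ((fst m)\<^sup>2 - (fst (snd m))\<^sup>2) - A m * fst m)"
  have nz: "2 * fst (snd m) \<noteq> 0" "fst (snd m) \<noteq> 0" if "m \<in> coord_domain" for m
    using that by (auto simp: coord_domain_def)
  have sB: "smooth_on coord_domain B"
    unfolding B_def by (intro smooth_intros smooth_on_pd V nz)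
  have sA: "smooth_on coord_domain A"
    unfolding A_def by (intro smooth_intros V sB nz)
  have sE: "smooth_on coord_domain E"
    unfolding E_def by (intro smooth_intros U sB sA)
  have VxB: "pdx V (x, y, p, q) = 2 * y * B (x, y, p, q)" if "y > 0" for x y p q
    using that by (simp add: B_def)
  have Bx: "pdx B (x, y, p, q) = 0" and By: "pdy B (x, y, p, q) = 0" if "y > 0" for x y p q
    by (rule pd_eqI(1)[OF sB that], simp add: B_def,
        use that Vxx[OF that] in \<open>auto intro!: derivative_eq_intros D(1)[OF smooth_on_pd(1)[OF V] that]\<close>)
      (rule pd_eqI(2)[OF sB that], simp add: B_def,
        use that Vxy[OF that] in \<open>auto intro!: derivative_eq_intros D(2)[OF smooth_on_pd(1)[OF V] that]\<close>)
  have Ax: "pdx A (x, y, p, q) = 0" if "y > 0" for x y p q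
    by (rule pd_eqI(1)[OF sA that], simp add: A_def)
      (use that Bx[OF that] in \<open>auto intro!: derivative_eq_intros D(1)[OF V that] D(1)[OF sB that] simp: VxB\<close>)
  have Ay: "pdy A (x, y, p, q) = 0" if "y > 0" for x y p q
    by (rule pd_eqI(2)[OF sA that], simp add: A_def)
      (use that By[OF that] Vy[OF that] in \<open>auto intro!: derivative_eq_intros D(2)[OF V that] D(2)[OF sB that]\<close>)
  have VA: "V (x, y, p, q) / y = A (x, y, p, q) + 2 * x * B (x, y, p, q)" for x y p q
    by (simp add: A_def)
  have Ex: "pdx E (x, y, p, q) = 0" if "y > 0" for x y p q
    by (rule pd_eqI(1)[OF sE that], simp add: E_def)
      (use that Bx[OF that] Ax[OF that] Ux[OF that] in
        \<open>auto intro!: derivative_eq_intros D(1)[OF U that] D(1)[OF sB that] D(1)[OF sA that] simp: VA\<close>)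
  have Ey: "pdy E (x, y, p, q) = 0" if "y > 0" for x y p q
    by (rule pd_eqI(2)[OF sE that], simp add: E_def)
      (use that By[OF that] Ay[OF that] Uy[OF that] in
        \<open>auto intro!: derivative_eq_intros D(2)[OF U that] D(2)[OF sB that] D(2)[OF sA that] simp: VxB\<close>)
  show ?thesis
  proof (rule that)
    show "fibre_function A" "fibre_function B" "fibre_function E"
      using sA sB sE Ax Ay Bx By Ex Ey by (auto simp: fibre_function_def)
  qed (auto simp: A_def E_def)
qed

lemma cubic_eq_zero:
  fixes a b c d :: real
  assumes "\<And>x. a * x ^ 3 + b * x\<^sup>2 + c * x + d = 0"
  shows "a = 0" "b = 0" "c = 0" "d = 0"
  using assms[of 0] assms[of 1] assms[of "-1"] assms[of 2] by auto

text \<open>The integrability condition \<open>W\<^sub>x\<^sub>y = W\<^sub>y\<^sub>x\<close>. It reads \<open>3 P(x) = y\<^sup>2 Q(x)\<close> for all \<open>y > 0\<close> with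
  polynomials \<open>P\<close>, \<open>Q\<close>, so \<open>P\<close> vanishes, and its four coefficients are the four asserted relations. In the
  application \<open>ap\<close>, \<open>aq\<close> and so on are the derivatives of \<open>A\<close>, \<open>B\<close>, \<open>E\<close> at \<open>(p, q)\<close>.\<close>

lemma mixed_derivatives_force:
  fixes ap aq bp bq ep eq K p q :: real
  assumes W: "smooth_on coord_domain W" and "K \<noteq> 0"
    and Wx: "\<And>x y. y > 0 \<Longrightarrow> pdx W (x, y, p, q) = - K / y ^ 3 *
      ((bp - x * bq) * (x\<^sup>2 - y\<^sup>2) + (ap - x * aq) * x + (ep - x * eq))"
    and Wy: "\<And>x y. y > 0 \<Longrightarrow> pdy W (x, y, p, q) = - K / y\<^sup>2 * ((ap - x * aq) + 2 * x * (bp - x * bq))"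
  shows "bq = 0" "bp = aq" "ap = eq" "ep = 0"
proof -
  have poly: "- bq * x ^ 3 + (bp - aq) * x\<^sup>2 + (ap - eq) * x + ep = 0" for x
  proof -
    define P where "P = (bp - x * bq) * x\<^sup>2 + (ap - x * aq) * x + (ep - x * eq)"
    have *: "3 * P = y\<^sup>2 * (aq - (bp - x * bq) + 2 * x * bq)" if y: "y > 0" for y
    proof -
      have "pdy (pdx W) (x, y, p, q) = - K * (- 3 * P / y ^ 4 + (bp - x * bq) / y\<^sup>2)"
      proof (rule pd_eqI(2)[OF smooth_on_pd(1)[OF W] y])
        show "pdx W (x, t, p, q) = - K * (P / t ^ 3 - (bp - x * bq) / t)" if "t > 0" for t
        proof -
          have "(bp - x * bq) * (x\<^sup>2 - t\<^sup>2) + (ap - x * aq) * x + (ep - x * eq) = P - (bp - x * bq) * t\<^sup>2"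
            unfolding P_def by algebra
          moreover have "- K / t ^ 3 * (P - b * t\<^sup>2) = - K * (P / t ^ 3 - b / t)" for b
            using that by (simp add: field_simps power2_eq_square power3_eq_cube)
          ultimately show ?thesis unfolding Wx[OF that] by simp
        qed
        show "((\<lambda>t. - K * (P / t ^ 3 - (bp - x * bq) / t)) has_field_derivative
            - K * (- 3 * P / y ^ 4 + (bp - x * bq) / y\<^sup>2)) (at y)"
          using y by (auto intro!: derivative_eq_intros simp: field_simps power2_eq_square power3_eq_cube
              power4_eq_xxxx)
      qed
      moreover have "pdx (pdy W) (x, y, p, q) = - K / y\<^sup>2 * (- aq + 2 * (bp - x * bq) - 2 * x * bq)"
      proof (rule pd_eqI(1)[OF smooth_on_pd(2)[OF W] y])
        show "pdy W (t, y, p, q) = - K / y\<^sup>2 * ((ap - t * aq) + 2 * t * (bp - t * bq))" for t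
          unfolding Wy[OF y] by simp
        show "((\<lambda>t. - K / y\<^sup>2 * ((ap - t * aq) + 2 * t * (bp - t * bq))) has_field_derivative
          - K / y\<^sup>2 * (- aq + 2 * (bp - x * bq) - 2 * x * bq)) (at x)"
          by (rule DERIV_cmult) (auto intro!: derivative_eq_intros simp: algebra_simps)
      qed
      ultimately have "- K * (- 3 * P / y ^ 4 + (bp - x * bq) / y\<^sup>2) = - K / y\<^sup>2 * (- aq
          + 2 * (bp - x * bq) - 2 * x * bq)"
        using pd_commute(1)[OF W y] by simp
      then have "- K * (- 3 * P / y ^ 4 + (bp - x * bq) / y\<^sup>2) = - K * ((- aq
          + 2 * (bp - x * bq) - 2 * x * bq) / y\<^sup>2)"
        by simp
      then have "- 3 * P / y ^ 4 + (bp - x * bq) / y\<^sup>2 = (- aq + 2 * (bp - x * bq) - 2 * x * bq) / y\<^sup>2"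
        using \<open>K \<noteq> 0\<close> by (metis mult_left_cancel neg_equal_0_iff_equal)
      then have "(- 3 * P / y ^ 4 + (bp - x * bq) / y\<^sup>2) - (- aq + 2 * (bp - x * bq) - 2 * x * bq) / y\<^sup>2 = 0"
        by simp
      then have "y ^ 4 * ((- 3 * P / y ^ 4 + (bp - x * bq) / y\<^sup>2) - (- aq
          + 2 * (bp - x * bq) - 2 * x * bq) / y\<^sup>2) = 0"
        by simp
      moreover have "y ^ 4 * (Z / y ^ 4) = Z" "y ^ 4 * (Z / y\<^sup>2) = y\<^sup>2 * Z" for Z
        using y by (simp_all add: power4_eq_xxxx power2_eq_square)
      ultimately show ?thesis by (simp only: right_diff_distrib distrib_left)
    qed
    have "P = 0" using *[of 1] *[of 2] by simp
    then show ?thesis by (simp add: P_def algebra_simps power2_eq_square power3_eq_cube)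
  qed
  from cubic_eq_zero[OF this] show "bq = 0" "bp = aq" "ap = eq" "ep = 0" by simp_all
qed

text \<open>Throughout, \<open>U\<close>, \<open>V\<close>, \<open>W\<close>, \<open>Z\<close> are the components of the field, and \<open>A\<close>, \<open>B\<close>, \<open>E\<close>, \<open>M\<close>, \<open>N\<close> are the
  functions of \<open>(p, q)\<close> described at the beginning. The constants \<open>c\<^sub>1\<close>, \<open>c\<^sub>2\<close> enter
  only through \<open>K = c\<^sub>1 / (4 c\<^sub>2)\<close>.\<close>

lemma killing_equations_solution:
  assumes c: "c1 > 0" "c2 > 0" and X: "smooth_on coord_domain X" and eqs: "killing_equations c1 c2 X"
  obtains f g h a b where "\<And>x y p q. y > 0 \<Longrightarrow> X (x, y, p, q) =
    (f + g * (y\<^sup>2 - x\<^sup>2) + 2 * h * x, - 2 * g * x * y + 2 * h * y, - g * q - h * p + a, - f * p + h * q + b)"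
proof -
  define U V W Z where "U = (\<lambda>m. fst (X m))" and "V = (\<lambda>m. fst (snd (X m)))"
    and "W = (\<lambda>m. fst (snd (snd (X m))))" and "Z = (\<lambda>m. snd (snd (snd (X m))))"
  note l = smooth_on_linear_compose[OF open_coord_domain]
  note f = l[OF bounded_linear_fst] and g = l[OF bounded_linear_snd]
  have smooth: "smooth_on coord_domain U" "smooth_on coord_domain V" "smooth_on coord_domain W"
    "smooth_on coord_domain Z"
    using f[OF X] f[OF g[OF X]] f[OF g[OF g[OF X]]] g[OF g[OF g[OF X]]]
    by (simp_all add: U_def V_def W_def Z_def)
  note U = smooth(1) and V = smooth(2) and W = smooth(3) and Z = smooth(4)
  note D = pd_has_field_derivative
  define K where "K = c1 / (4 * c2)"
  have K: "K \<noteq> 0" "c1 = 4 * c2 * K" using c by (auto simp: K_def)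
  have comp: "fst (X m) = U m" "fst (snd (X m)) = V m" "fst (snd (snd (X m))) = W m" "snd (snd (snd (X m)))
      = Z m" for m
    by (simp_all add: U_def V_def W_def Z_def)
  note killing = eqs[unfolded killing_equations_def Let_def comp, rule_format]
  have Ux: "pdx U (x, y, p, q) = V (x, y, p, q) / y"
    and Vy: "pdy V (x, y, p, q) = V (x, y, p, q) / y"
    and Uy: "pdy U (x, y, p, q) = - pdx V (x, y, p, q)" if "y > 0" for x y p q
    using killing[OF that, of x p q] that by (auto simp: field_simps)
  obtain A B E where A: "fibre_function A" and B: "fibre_function B" and E: "fibre_function E"
    and V_eq: "\<And>x y p q. y > 0 \<Longrightarrow> V (x, y, p, q) = y * (A (x, y, p, q) + 2 * x * B (x, y, p, q))"
    and U_eq: "\<And>x y p q. y > 0 \<Longrightarrow> U (x, y, p, q) =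
      B (x, y, p, q) * (x\<^sup>2 - y\<^sup>2) + A (x, y, p, q) * x + E (x, y, p, q)"
    using half_plane_killing_field[OF U V Ux Vy Uy] by blast
  note sA = fibre_function_smooth[OF A] and sB = fibre_function_smooth[OF B] and sE = fibre_function_smooth[OF E]
  have const: "F (x, y, p, q) = F (0, 1, p, q)" "pdp F (x, y, p, q) = pdp F (0, 1, p, q)"
    "pdq F (x, y, p, q) = pdq F (0, 1, p, q)" if "fibre_function F" "y > 0" for F x y p q
    using fibre_function_const[OF _ that(2)] fibre_function_pd[OF that(1)] that(1) by blast+
  have Up: "pdp U (x, y, p, q) = pdp B (0, 1, p, q) * (x\<^sup>2 - y\<^sup>2) + pdp A (0, 1, p, q) * x + pdp E (0, 1, p, q)"
    and Uq: "pdq U (x, y, p, q) = pdq B (0, 1, p, q) * (x\<^sup>2 - y\<^sup>2) + pdq A (0, 1, p, q) * x + pdq E (0, 1, p, q)"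
    and Vp: "pdp V (x, y, p, q) = y * (pdp A (0, 1, p, q) + 2 * x * pdp B (0, 1, p, q))"
    and Vq: "pdq V (x, y, p, q) = y * (pdq A (0, 1, p, q) + 2 * x * pdq B (0, 1, p, q))" if y: "y > 0" for x y p q
  proof -
    note c = const[OF A y, where x = x and p = p and q = q, symmetric]
      const[OF B y, where x = x and p = p and q = q, symmetric]
      const[OF E y, where x = x and p = p and q = q, symmetric]
    show "pdp U (x, y, p, q) = pdp B (0, 1, p, q) * (x\<^sup>2 - y\<^sup>2) + pdp A (0, 1, p, q) * x + pdp E (0, 1, p, q)"
      unfolding c by (rule pd_eqI(3)[OF U y U_eq[OF y]])
        (auto intro!: derivative_eq_intros D(3)[OF sA y] D(3)[OF sB y] D(3)[OF sE y])
    show "pdq U (x, y, p, q) = pdq B (0, 1, p, q) * (x\<^sup>2 - y\<^sup>2) + pdq A (0, 1, p, q) * x + pdq E (0, 1, p, q)"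
      unfolding c by (rule pd_eqI(4)[OF U y U_eq[OF y]])
        (auto intro!: derivative_eq_intros D(4)[OF sA y] D(4)[OF sB y] D(4)[OF sE y])
    show "pdp V (x, y, p, q) = y * (pdp A (0, 1, p, q) + 2 * x * pdp B (0, 1, p, q))"
      unfolding c by (rule pd_eqI(3)[OF V y V_eq[OF y]])
        (auto intro!: derivative_eq_intros D(3)[OF sA y] D(3)[OF sB y])
    show "pdq V (x, y, p, q) = y * (pdq A (0, 1, p, q) + 2 * x * pdq B (0, 1, p, q))"
      unfolding c by (rule pd_eqI(4)[OF V y V_eq[OF y]])
        (auto intro!: derivative_eq_intros D(4)[OF sA y] D(4)[OF sB y])
  qed
  \<comment> \<open>For each base direction, two of the mixed equations form a linear system with determinant \<open>y\<^sup>2\<close>.\<close>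
  have solve: "w = - K / y ^ 3 * (u - x * v)" "z = - K / y * v - x * w"
    if y: "y > 0" and e: "c2 * ((x\<^sup>2 + y\<^sup>2) * w + x * z) + c1 / (4 * y) * u = 0"
      "c1 / (4 * y) * v + c2 * (x * w + z) = 0" for x y u v w z :: real
  proof -
    have div: "c1 / (4 * y) = c2 * (K / y)" using K(2) by simp
    have "c2 * ((x\<^sup>2 + y\<^sup>2) * w + x * z + K / y * u) = 0" "c2 * (K / y * v + x * w + z) = 0"
      using e unfolding div by (simp_all add: algebra_simps)
    then have e': "(x\<^sup>2 + y\<^sup>2) * w + x * z + K / y * u = 0" "K / y * v + x * w + z = 0"
      using c by simp_all
    show z: "z = - K / y * v - x * w" using e'(2) by simp
    have "y\<^sup>2 * w = - (K / y) * (u - x * v)" using e' by algebra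
    then show "w = - K / y ^ 3 * (u - x * v)" using y
      by (simp add: field_simps power2_eq_square power3_eq_cube)
  qed
  have Wx: "pdx W (x, y, p, q) = - K / y ^ 3 * (pdp U (x, y, p, q) - x * pdq U (x, y, p, q))"
    and Zx: "pdx Z (x, y, p, q) = - K / y * pdq U (x, y, p, q) - x * pdx W (x, y, p, q)"
    and Wy: "pdy W (x, y, p, q) = - K / y ^ 3 * (pdp V (x, y, p, q) - x * pdq V (x, y, p, q))"
    and Zy: "pdy Z (x, y, p, q) = - K / y * pdq V (x, y, p, q) - x * pdy W (x, y, p, q)" if y: "y > 0" for x y p q
  proof -
    note k = killing[OF y, of x p q]
    have x: "c2 * ((x\<^sup>2 + y\<^sup>2) * pdx W (x, y, p, q) + x * pdx Z (x, y, p, q))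
        + c1 / (4 * y) * pdp U (x, y, p, q) = 0"
      "c1 / (4 * y) * pdq U (x, y, p, q) + c2 * (x * pdx W (x, y, p, q) + pdx Z (x, y, p, q)) = 0"
      using k by blast+
    have y': "c2 * ((x\<^sup>2 + y\<^sup>2) * pdy W (x, y, p, q) + x * pdy Z (x, y, p, q))
        + c1 / (4 * y) * pdp V (x, y, p, q) = 0"
      "c1 / (4 * y) * pdq V (x, y, p, q) + c2 * (x * pdy W (x, y, p, q) + pdy Z (x, y, p, q)) = 0"
      using k by (blast, metis add.commute)
    show "pdx W (x, y, p, q) = - K / y ^ 3 * (pdp U (x, y, p, q) - x * pdq U (x, y, p, q))"
      "pdx Z (x, y, p, q) = - K / y * pdq U (x, y, p, q) - x * pdx W (x, y, p, q)"
      "pdy W (x, y, p, q) = - K / y ^ 3 * (pdp V (x, y, p, q) - x * pdq V (x, y, p, q))"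
      "pdy Z (x, y, p, q) = - K / y * pdq V (x, y, p, q) - x * pdy W (x, y, p, q)"
      using solve[OF y x] solve[OF y y'] by blast+
  qed
  have integrable: "pdq B (0, 1, p, q) = 0" "pdp B (0, 1, p, q) = pdq A (0, 1, p, q)"
    "pdp A (0, 1, p, q) = pdq E (0, 1, p, q)" "pdp E (0, 1, p, q) = 0" for p q
  proof -
    have 1: "pdx W (x, y, p, q) = - K / y ^ 3 *
      ((pdp B (0, 1, p, q) - x * pdq B (0, 1, p, q)) * (x\<^sup>2 - y\<^sup>2)
        + (pdp A (0, 1, p, q) - x * pdq A (0, 1, p, q)) * x + (pdp E (0, 1, p, q) - x * pdq E (0, 1, p, q)))"
      if y: "y > 0" for x y
      unfolding Wx[OF y] Up[OF y] Uq[OF y] by (simp add: algebra_simps)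
    have 2: "pdy W (x, y, p, q) = - K / y\<^sup>2 *
      ((pdp A (0, 1, p, q) - x * pdq A (0, 1, p, q)) + 2 * x * (pdp B (0, 1, p, q) - x * pdq B (0, 1, p, q)))"
      if y: "y > 0" for x y
    proof -
      have "- K / y ^ 3 * (y * T) = - K / y\<^sup>2 * T" for T
        using y by (simp add: power2_eq_square power3_eq_cube)
      moreover have "pdp V (x, y, p, q) - x * pdq V (x, y, p, q) = y *
        ((pdp A (0, 1, p, q) - x * pdq A (0, 1, p, q)) + 2 * x * (pdp B (0, 1, p, q) - x * pdq B (0, 1, p, q)))"
        unfolding Vp[OF y] Vq[OF y] by algebra
      ultimately show ?thesis unfolding Wy[OF y] by simp
    qed
    from mixed_derivatives_force[OF W K(1) 1 2]
    show "pdq B (0, 1, p, q) = 0" "pdp B (0, 1, p, q) = pdq A (0, 1, p, q)"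
      "pdp A (0, 1, p, q) = pdq E (0, 1, p, q)" "pdp E (0, 1, p, q) = 0" by blast+
  qed
  have one: "(0::real) < 1" by simp
  \<comment> \<open>Of the second derivatives that enter below, only \<open>A\<^sub>p\<^sub>q\<close> and \<open>B\<^sub>p\<^sub>p\<close> are not yet known to vanish.\<close>
  have Bpq: "pdq (pdp B) (0, 1, p, q) = 0" "pdp (pdq B) (0, 1, p, q) = 0" for p q
  proof -
    show "pdp (pdq B) (0, 1, p, q) = 0"
      by (rule pd_eqI(3)[OF smooth_on_pd(4)[OF sB] one, of _ _ "\<lambda>_. 0"]) (auto simp: integrable)
    then show "pdq (pdp B) (0, 1, p, q) = 0" using pd_commute(6)[OF sB one] by simp
  qed
  have App: "pdp (pdp A) (0, 1, p, q) = 0" for p q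
  proof -
    have "pdq (pdp E) (0, 1, p, q) = 0"
      by (rule pd_eqI(4)[OF smooth_on_pd(3)[OF sE] one, of _ _ "\<lambda>_. 0"]) (auto simp: integrable)
    then have "pdp (pdq E) (0, 1, p, q) = 0" using pd_commute(6)[OF sE one] by simp
    then show ?thesis
      using pd_eqI(3)[OF smooth_on_pd(3)[OF sA] one integrable(3), of q "pdp (pdq E) (0, 1, p, q)" p]
        D(3)[OF smooth_on_pd(4)[OF sE] one] by metis
  qed
  have Wx': "pdx W (x, y, p, q) = K / y * pdp B (0, 1, p, q)"
    and Wy': "pdy W (x, y, p, q) = - K / y\<^sup>2 * (pdp A (0, 1, p, q) + x * pdp B (0, 1, p, q))"
    and Zx': "pdx Z (x, y, p, q) = - K / y * (pdp A (0, 1, p, q) + 2 * x * pdp B (0, 1, p, q))"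
    and Zy': "pdy Z (x, y, p, q) = - K * (pdp B (0, 1, p, q) - x / y\<^sup>2 * (pdp A (0, 1, p, q)
        + x * pdp B (0, 1, p, q)))"
    if y: "y > 0" for x y p q
  proof -
    show x: "pdx W (x, y, p, q) = K / y * pdp B (0, 1, p, q)"
      unfolding Wx[OF y] Up[OF y] Uq[OF y] using y
      by (simp add: integrable(1,4) integrable(2)[symmetric] integrable(3)[symmetric])
        (simp add: field_simps power2_eq_square power3_eq_cube)
    show y': "pdy W (x, y, p, q) = - K / y\<^sup>2 * (pdp A (0, 1, p, q) + x * pdp B (0, 1, p, q))"
      unfolding Wy[OF y] Vp[OF y] Vq[OF y] using y
      by (simp add: integrable(1,4) integrable(2)[symmetric])
        (simp add: field_simps power2_eq_square power3_eq_cube)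
    show "pdx Z (x, y, p, q) = - K / y * (pdp A (0, 1, p, q) + 2 * x * pdp B (0, 1, p, q))"
      unfolding Zx[OF y] x Uq[OF y] using y
      by (simp add: integrable(1,4) integrable(2)[symmetric] integrable(3)[symmetric])
        (simp add: field_simps)
    show "pdy Z (x, y, p, q) = - K * (pdp B (0, 1, p, q) - x / y\<^sup>2 * (pdp A (0, 1, p, q) + x * pdp B (0, 1, p, q)))"
      unfolding Zy[OF y] y' Vq[OF y] using y
      by (simp add: integrable(1,4) integrable(2)[symmetric])
        (simp add: field_simps)
  qed
  \<comment> \<open>Subtract explicit antiderivatives; what is left depends on \<open>(p, q)\<close> only.\<close>
  define M where "M = (\<lambda>m. W m - K * (pdp A m + fst m * pdp B m) / fst (snd m))"
  define N where "N = (\<lambda>m. Z m + K * (fst (snd m) * pdp B m + fst m * (pdp A m + fst m * pdp B m) / fst (snd m)))"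
  have sM: "smooth_on coord_domain M" and sN: "smooth_on coord_domain N"
    unfolding M_def N_def by (intro smooth_intros smooth_on_pd W Z sA sB; auto simp: coord_domain_def)+
  have W_eq: "W (x, y, p, q) = M (x, y, p, q) + K * (pdp A (0, 1, p, q) + x * pdp B (0, 1, p, q)) / y"
    and Z_eq: "Z (x, y, p, q) = N (x, y, p, q) - K * (y * pdp B (0, 1, p, q) + x * (pdp A (0, 1, p, q)
        + x * pdp B (0, 1, p, q)) / y)"
    if "y > 0" for x y p q
    by (simp_all add: M_def N_def const[OF A that, where x = x, symmetric] const[OF B that, where x = x, symmetric])
  have M: "fibre_function M"
    unfolding fibre_function_def
  proof (intro conjI sM allI impI)
    fix x y p q :: real assume y: "y > 0"
    show "pdx M (x, y, p, q) = 0"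
    proof (rule pd_eqI(1)[OF sM y])
      show "M (t, y, p, q) = W (t, y, p, q) - K * (pdp A (0, 1, p, q) + t * pdp B (0, 1, p, q)) / y" for t
        using W_eq[OF y] by simp
    qed (use y in \<open>auto intro!: derivative_eq_intros D(1)[OF W y] simp: Wx'\<close>)
    show "pdy M (x, y, p, q) = 0"
    proof (rule pd_eqI(2)[OF sM y])
      show "M (x, t, p, q) = W (x, t, p, q) - K * (pdp A (0, 1, p, q) + x * pdp B (0, 1, p, q)) / t" if
          "t > 0" for t
        using W_eq[OF that] by simp
    qed (use y in \<open>auto intro!: derivative_eq_intros D(2)[OF W y] simp: Wy' power2_eq_square\<close>)
  qed
  have N: "fibre_function N"
    unfolding fibre_function_def
  proof (intro conjI sN allI impI)
    fix x y p q :: real assume y: "y > 0"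
    show "pdx N (x, y, p, q) = 0"
    proof (rule pd_eqI(1)[OF sN y])
      show "N (t, y, p, q) = Z (t, y, p, q) + K * (y * pdp B (0, 1, p, q) + t * (pdp A (0, 1, p, q)
          + t * pdp B (0, 1, p, q)) / y)" for t
        using Z_eq[OF y] by simp
    qed (use y in \<open>auto intro!: derivative_eq_intros D(1)[OF Z y] simp: Zx' field_simps\<close>)
    show "pdy N (x, y, p, q) = 0"
    proof (rule pd_eqI(2)[OF sN y])
      show "N (x, t, p, q) = Z (x, t, p, q) + K * (t * pdp B (0, 1, p, q) + x * (pdp A (0, 1, p, q)
          + x * pdp B (0, 1, p, q)) / t)" if "t > 0" for t
        using Z_eq[OF that] by simp
    qed (use y in \<open>auto intro!: derivative_eq_intros D(2)[OF Z y] simp: Zy' field_simps power2_eq_square\<close>)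
  qed
  \<comment> \<open>On the line \<open>y = 1\<close> the fibre equations become polynomial identities in \<open>x\<close>.\<close>
  note DA = D(3)[OF smooth_on_pd(3)[OF sA] one] D(4)[OF smooth_on_pd(3)[OF sA] one]
  note DB = D(3)[OF smooth_on_pd(3)[OF sB] one] D(4)[OF smooth_on_pd(3)[OF sB] one]
  have Wp: "pdp W (x, 1, p, q) = pdp M (0, 1, p, q) + K * x * pdp (pdp B) (0, 1, p, q)"
    and Wq: "pdq W (x, 1, p, q) = pdq M (0, 1, p, q) + K * pdq (pdp A) (0, 1, p, q)"
    and Zp: "pdp Z (x, 1, p, q) = pdp N (0, 1, p, q) - K * (1 + x\<^sup>2) * pdp (pdp B) (0, 1, p, q)"
    and Zq: "pdq Z (x, 1, p, q) = pdq N (0, 1, p, q) - K * x * pdq (pdp A) (0, 1, p, q)" for x p q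
  proof -
    note c = const[OF M one, where x = x, symmetric] const[OF N one, where x = x, symmetric]
    show "pdp W (x, 1, p, q) = pdp M (0, 1, p, q) + K * x * pdp (pdp B) (0, 1, p, q)"
      unfolding c by (rule pd_eqI(3)[OF W one W_eq[OF one]])
        (auto intro!: derivative_eq_intros D(3)[OF sM one] DA DB simp: App)
    show "pdq W (x, 1, p, q) = pdq M (0, 1, p, q) + K * pdq (pdp A) (0, 1, p, q)"
      unfolding c by (rule pd_eqI(4)[OF W one W_eq[OF one]])
        (auto intro!: derivative_eq_intros D(4)[OF sM one] DA DB simp: Bpq)
    show "pdp Z (x, 1, p, q) = pdp N (0, 1, p, q) - K * (1 + x\<^sup>2) * pdp (pdp B) (0, 1, p, q)"
      unfolding c by (rule pd_eqI(3)[OF Z one Z_eq[OF one]])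
        (auto intro!: derivative_eq_intros D(3)[OF sN one] DA DB simp: App algebra_simps power2_eq_square)
    show "pdq Z (x, 1, p, q) = pdq N (0, 1, p, q) - K * x * pdq (pdp A) (0, 1, p, q)"
      unfolding c by (rule pd_eqI(4)[OF Z one Z_eq[OF one]])
        (auto intro!: derivative_eq_intros D(4)[OF sN one] DA DB simp: Bpq)
  qed
  have MN: "pdp M (0, 1, p, q) = - A (0, 1, p, q) / 2" "pdq M (0, 1, p, q) = B (0, 1, p, q)"
    "pdp N (0, 1, p, q) = - E (0, 1, p, q)" "pdq N (0, 1, p, q) = A (0, 1, p, q) / 2" for p q
  proof -
    have fibre: "- (A (0, 1, p, q) + 2 * x * B (0, 1, p, q)) + 2 * x * pdq M (0, 1, p, q)
        + 2 * pdq N (0, 1, p, q) = 0"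
      "(1 + x\<^sup>2) * (A (0, 1, p, q) + 2 * pdp M (0, 1, p, q)) + 2 * x * (E (0, 1, p, q) + pdp N (0, 1, p, q))
          = 0" for x
    proof -
      have pp: "2 * x * 1 * U (x, 1, p, q) + (- x\<^sup>2 + 1\<^sup>2) * V (x, 1, p, q)
          + 2 * 1 * (x\<^sup>2 + 1\<^sup>2) * pdp W (x, 1, p, q) + 2 * x * 1 * pdp Z (x, 1, p, q) = 0"
        and qq: "- V (x, 1, p, q) + 2 * x * 1 * pdq W (x, 1, p, q) + 2 * 1 * pdq Z (x, 1, p, q) = 0"
        using killing[OF one, of x p q] by blast+
      note eq = V_eq[OF one] U_eq[OF one] const[OF A one, of x] const[OF B one, of x] const[OF E one, of x]
      show "- (A (0, 1, p, q) + 2 * x * B (0, 1, p, q)) + 2 * x * pdq M (0, 1, p, q) + 2 * pdq N (0, 1, p, q) = 0"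
        using qq unfolding Wq Zq eq by algebra
      show "(1 + x\<^sup>2) * (A (0, 1, p, q) + 2 * pdp M (0, 1, p, q)) + 2 * x * (E (0, 1, p, q)
          + pdp N (0, 1, p, q)) = 0"
        using pp unfolding Wp Zp eq power_one by algebra
    qed
    show "pdp M (0, 1, p, q) = - A (0, 1, p, q) / 2" "pdq M (0, 1, p, q) = B (0, 1, p, q)"
      "pdp N (0, 1, p, q) = - E (0, 1, p, q)" "pdq N (0, 1, p, q) = A (0, 1, p, q) / 2"
      using fibre(1)[of 0] fibre(1)[of 1] fibre(2)[of 0] fibre(2)[of 1] by simp_all
  qed
  \<comment> \<open>\<open>M\<^sub>p\<^sub>q = M\<^sub>q\<^sub>p\<close> reads \<open>- A\<^sub>q / 2 = B\<^sub>p\<close>, and \<open>N\<^sub>p\<^sub>q = N\<^sub>q\<^sub>p\<close> reads \<open>- E\<^sub>q = A\<^sub>p / 2\<close>. Compared with \<open>B\<^sub>p = A\<^sub>q\<close> and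
    \<open>A\<^sub>p = E\<^sub>q\<close>, all of these vanish.\<close>
  have zero: "pdq A (0, 1, p, q) = 0" "pdp A (0, 1, p, q) = 0" for p q
  proof -
    have "pdq (pdp M) (0, 1, p, q) = - pdq A (0, 1, p, q) / 2"
      by (rule pd_eqI(4)[OF smooth_on_pd(3)[OF sM] one MN(1)])
        (intro DERIV_cdivide DERIV_minus D(4)[OF sA one])
    moreover have "pdp (pdq M) (0, 1, p, q) = pdp B (0, 1, p, q)"
      by (rule pd_eqI(3)[OF smooth_on_pd(4)[OF sM] one MN(2)]) (rule D(3)[OF sB one])
    ultimately show "pdq A (0, 1, p, q) = 0" using pd_commute(6)[OF sM one, of 0 p q] integrable(2)[of p q] by simp
    have "pdq (pdp N) (0, 1, p, q) = - pdq E (0, 1, p, q)"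
      by (rule pd_eqI(4)[OF smooth_on_pd(3)[OF sN] one MN(3)])
        (intro DERIV_minus D(4)[OF sE one])
    moreover have "pdp (pdq N) (0, 1, p, q) = pdp A (0, 1, p, q) / 2"
      by (rule pd_eqI(3)[OF smooth_on_pd(4)[OF sN] one MN(4)]) (intro DERIV_cdivide D(3)[OF sA one])
    ultimately show "pdp A (0, 1, p, q) = 0" using pd_commute(6)[OF sN one, of 0 p q] integrable(3)[of p q] by simp
  qed
  define a b e where "a = A (0, 1, 0, 0)" and "b = B (0, 1, 0, 0)" and "e = E (0, 1, 0, 0)"
  have ABE: "A (x, y, p, q) = a" "B (x, y, p, q) = b" "E (x, y, p, q) = e" if "y > 0" for x y p q
    unfolding a_def b_def e_def
    using fibre_function_constant[OF A zero(2,1) that] fibre_function_constant[OF B _ integrable(1) that]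
      fibre_function_constant[OF E integrable(4) _ that] zero integrable
    by metis+
  have M_eq: "M (x, y, p, q) = M (0, 1, 0, 0) - a / 2 * p + b * q"
    and N_eq: "N (x, y, p, q) = N (0, 1, 0, 0) + a / 2 * q - e * p" if "y > 0" for x y p q
  proof -
    have "((\<lambda>t. M (0, 1, t, q) + a / 2 * t) has_field_derivative 0) (at t)" for t
      by (auto intro!: derivative_eq_intros D(3)[OF sM one] simp: MN(1) ABE[OF one])
    then have "M (0, 1, p, q) + a / 2 * p = M (0, 1, 0, q) + a / 2 * 0"
      using DERIV_isconst_all by blast
    moreover have "((\<lambda>t. M (0, 1, 0, t) - b * t) has_field_derivative 0) (at t)" for t
      by (auto intro!: derivative_eq_intros D(4)[OF sM one] simp: MN(2) ABE[OF one])
    then have "M (0, 1, 0, q) - b * q = M (0, 1, 0, 0) - b * 0"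
      using DERIV_isconst_all by blast
    ultimately show "M (x, y, p, q) = M (0, 1, 0, 0) - a / 2 * p + b * q"
      using const(1)[OF M that, of x p q] by simp
    have "((\<lambda>t. N (0, 1, t, q) + e * t) has_field_derivative 0) (at t)" for t
      by (auto intro!: derivative_eq_intros D(3)[OF sN one] simp: MN(3) ABE[OF one])
    then have "N (0, 1, p, q) + e * p = N (0, 1, 0, q) + e * 0"
      using DERIV_isconst_all by blast
    moreover have "((\<lambda>t. N (0, 1, 0, t) - a / 2 * t) has_field_derivative 0) (at t)" for t
      by (auto intro!: derivative_eq_intros D(4)[OF sN one] simp: MN(4) ABE[OF one])
    then have "N (0, 1, 0, q) - a / 2 * q = N (0, 1, 0, 0) - a / 2 * 0"
      using DERIV_isconst_all by blast
    ultimately show "N (x, y, p, q) = N (0, 1, 0, 0) + a / 2 * q - e * p"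
      using const(1)[OF N that, of x p q] by simp
  qed
  show ?thesis
  proof (rule that[of e "- b" "a / 2" "M (0, 1, 0, 0)" "N (0, 1, 0, 0)"])
    fix x y p q :: real assume y: "y > 0"
    have "pdp B (0, 1, p, q) = 0" "pdp A (0, 1, p, q) = 0" using integrable(2) zero by auto
    then have "U (x, y, p, q) = b * (x\<^sup>2 - y\<^sup>2) + a * x + e" "V (x, y, p, q) = y * (a + 2 * x * b)"
      "W (x, y, p, q) = M (0, 1, 0, 0) - a / 2 * p + b * q" "Z (x, y, p, q) = N (0, 1, 0, 0) + a / 2 * q - e * p"
      using U_eq[OF y] V_eq[OF y] W_eq[OF y] Z_eq[OF y] ABE[OF y] M_eq[OF y] N_eq[OF y] by simp_all
    moreover have "X (x, y, p, q) = (U (x, y, p, q), V (x, y, p, q), W (x, y, p, q), Z (x, y, p, q))"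
      by (simp add: U_def V_def W_def Z_def)
    ultimately show "X (x, y, p, q) = (e + - b * (y\<^sup>2 - x\<^sup>2) + 2 * (a / 2) * x, - 2 * - b * x * y + 2 * (a / 2) * y,
        - (- b) * q - a / 2 * p + M (0, 1, 0, 0), - e * p + a / 2 * q + N (0, 1, 0, 0))"
      by (simp add: algebra_simps)
  qed
qed

text \<open>The explicit form of the general linear combination of the fundamental vector fields. Since
  \<open>R\<close> contributes nothing, there are five parameters.\<close>

lemma jacobi_field_killing_equations:
  assumes X: "\<And>x y p q. y > 0 \<Longrightarrow> X (x, y, p, q) =
    (f + g * (y\<^sup>2 - x\<^sup>2) + 2 * h * x, - 2 * g * x * y + 2 * h * y, - g * q - h * p + a, - f * p + h * q + b)"
  shows "smooth_on coord_domain X" "killing_equations c1 c2 X"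
proof -
  have eq: "X m = (f + g * ((fst (snd m))\<^sup>2 - (fst m)\<^sup>2) + 2 * h * fst m,
      - 2 * g * fst m * fst (snd m) + 2 * h * fst (snd m),
      - g * snd (snd (snd m)) - h * fst (snd (snd m)) + a, - f * fst (snd (snd m)) + h * snd (snd (snd m)) + b)"
    if "m \<in> coord_domain" for m
    using that X by (cases m) (auto simp: coord_domain_def)
  show "smooth_on coord_domain X"
    by (subst smooth_on_cong[OF open_coord_domain eq], assumption) (intro smooth_on_Pair smooth_intros)
  have frechet: "frechet_derivative (\<lambda>m. fst (X m)) (at (x, y, p, q)) (dx, dy, dp, dq)
      = g * (2 * y * dy - 2 * x * dx) + 2 * h * dx"
    "frechet_derivative (\<lambda>m. fst (snd (X m))) (at (x, y, p, q)) (dx, dy, dp, dq) = - 2 * g * (dx * y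
        + x * dy) + 2 * h * dy"
    "frechet_derivative (\<lambda>m. fst (snd (snd (X m)))) (at (x, y, p, q)) (dx, dy, dp, dq) = - g * dq - h * dp"
    "frechet_derivative (\<lambda>m. snd (snd (snd (X m)))) (at (x, y, p, q)) (dx, dy, dp, dq) = - f * dp + h * dq"
    if y: "y > 0" for x y p q dx dy dp dq
  proof -
    have m: "(x, y, p, q) \<in> coord_domain" using y by (simp add: coord_domain_def)
    have D: "(X has_derivative (\<lambda>(dx, dy, dp, dq). (g * (2 * y * dy - 2 * x * dx) + 2 * h * dx,
      - 2 * g * (dx * y + x * dy) + 2 * h * dy, - g * dq - h * dp, - f * dp + h * dq))) (at (x, y, p, q))"
      by (rule has_derivative_transform_within_open[OF _ open_coord_domain m eq[symmetric]])
        (auto intro!: derivative_eq_intros ext simp: algebra_simps)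
    note fst = has_derivative_fst and snd = has_derivative_snd
    note frechet = frechet_derivative_at[OF fst[OF D], symmetric] frechet_derivative_at[OF fst[OF snd[OF
        D]], symmetric]
      frechet_derivative_at[OF fst[OF snd[OF snd[OF D]]], symmetric]
      frechet_derivative_at[OF snd[OF snd[OF snd[OF D]]], symmetric]
    show "frechet_derivative (\<lambda>m. fst (X m)) (at (x, y, p, q)) (dx, dy, dp, dq)
        = g * (2 * y * dy - 2 * x * dx) + 2 * h * dx"
      "frechet_derivative (\<lambda>m. fst (snd (X m))) (at (x, y, p, q)) (dx, dy, dp, dq) = - 2 * g * (dx * y
          + x * dy) + 2 * h * dy"
      "frechet_derivative (\<lambda>m. fst (snd (snd (X m)))) (at (x, y, p, q)) (dx, dy, dp, dq) = - g * dq - h * dp"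
      "frechet_derivative (\<lambda>m. snd (snd (snd (X m)))) (at (x, y, p, q)) (dx, dy, dp, dq) = - f * dp + h * dq"
      unfolding frechet by simp_all
  qed
  show "killing_equations c1 c2 X"
    unfolding killing_equations_def Let_def pdx_def pdy_def pdp_def pdq_def
    by (simp add: frechet X) (simp add: algebra_simps power2_eq_square)
qed

section \<open>The balanced metric on the Siegel--Jacobi upper half-plane\<close>

theorem proposition5p4:
  fixes c1 c2 \<alpha> \<gamma> :: real
  assumes "c1 > 0" and "c2 > 0" and "\<alpha> = c1 / 4" and "\<gamma> = c2"
  shows
    "\<comment> \<open>(1) the line element in real variables\<close>
     (\<forall>x y p q dx dy dp dq. y > 0 \<longrightarrow>
        ds2_xypq c1 c2 (x, y, p, q) (dx, dy, dp, dq) = complex_of_real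
          (c1 * (dx\<^sup>2 + dy\<^sup>2) / (4 * y\<^sup>2)
            + c2 / y * ((x\<^sup>2 + y\<^sup>2) * dp\<^sup>2 + dq\<^sup>2 + 2 * x * dp * dq)) \<and>
        ds2_xypq c1 c2 (x, y, p, q) (dx, dy, dp, dq) = complex_of_real
          (c1 * (dx\<^sup>2 + dy\<^sup>2) / (4 * y\<^sup>2)
            + c2 * ((x\<^sup>2 + y\<^sup>2) / y) *
              ((dp + x / (x\<^sup>2 + y\<^sup>2) * dq)\<^sup>2 + (y * dq / (x\<^sup>2 + y\<^sup>2))\<^sup>2))) \<and>
     (\<forall>x y \<xi> \<eta> dx dy d\<xi> d\<eta>. y > 0 \<longrightarrow>
        ds2_xyxieta c1 c2 (x, y, \<xi>, \<eta>) (dx, dy, d\<xi>, d\<eta>) = complex_of_real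
          (c1 * (dx\<^sup>2 + dy\<^sup>2) / (4 * y\<^sup>2)
            + c2 / y * (d\<xi>\<^sup>2 + d\<eta>\<^sup>2 + (\<eta> / y)\<^sup>2 * (dx\<^sup>2 + dy\<^sup>2)
                - 2 * (\<eta> / y) * (dx * d\<xi> + dy * d\<eta>)))) \<and>
     \<comment> \<open>(2) invariance and the Kaehler property\<close>
     (\<forall>h \<in> carrier reduced_jacobi.
        preserves_metric_on siegel_jacobi (balanced_metric c1 c2) (jacobi_act h)) \<and>
     kaehler_on siegel_jacobi (balanced_metric c1 c2) \<and>
     \<comment> \<open>(3) the matrix of the metric, the one-forms and the frame\<close>
     (\<forall>x y p q. y > 0 \<longrightarrow>
        metric_matrix (metric_xypq c1 c2) (x, y, p, q) =
          vector [vector [\<alpha> / y\<^sup>2, 0, 0, 0],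
                  vector [0, \<alpha> / y\<^sup>2, 0, 0],
                  vector [0, 0, \<gamma> * ((x\<^sup>2 + y\<^sup>2) / y), \<gamma> * (x / y)],
                  vector [0, 0, \<gamma> * (x / y), \<gamma> / y]]) \<and>
     (\<forall>\<theta>. \<forall>m \<in> coord_domain. \<forall>v.
        ds2_xypq c1 c2 m v =
          complex_of_real (\<Sum>i\<in>{1, 2, 4, 5}. (inv_form \<alpha> \<gamma> \<theta> i m v)\<^sup>2)) \<and>
     (\<forall>\<theta>. \<forall>m \<in> coord_domain. \<forall>i \<in> {1, 2, 4, 5}. \<forall>j \<in> {1, 2, 4, 5}.
        inv_form \<alpha> \<gamma> \<theta> i m (inv_frame \<alpha> \<gamma> \<theta> j m) = (if i = j then 1 else 0) \<and>
        metric_xypq c1 c2 m (inv_frame \<alpha> \<gamma> \<theta> i m) (inv_frame \<alpha> \<gamma> \<theta> j m) =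
          (if i = j then 1 else 0)) \<and>
     \<comment> \<open>(4) the fundamental vector fields and the Killing equations\<close>
     (\<forall>x y p q. y > 0 \<longrightarrow>
        fundamental_xypq gen_F (x, y, p, q) = (1, 0, 0, - p) \<and>
        fundamental_xypq gen_G (x, y, p, q) = (y\<^sup>2 - x\<^sup>2, - 2 * x * y, - q, 0) \<and>
        fundamental_xypq gen_H (x, y, p, q) = (2 * x, 2 * y, - p, q) \<and>
        fundamental_xypq gen_P (x, y, p, q) = (0, 0, 1, 0) \<and>
        fundamental_xypq gen_Q (x, y, p, q) = (0, 0, 0, 1) \<and>
        fundamental_xypq gen_R (x, y, p, q) = (0, 0, 0, 0)) \<and>
     (\<forall>X. smooth_on coord_domain X \<longrightarrow>
        (killing_on coord_domain (metric_xypq c1 c2) X \<longleftrightarrow> killing_equations c1 c2 X)) \<and>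
     (\<forall>V \<in> {gen_F, gen_G, gen_H, gen_P, gen_Q, gen_R}.
        smooth_on coord_domain (fundamental_xypq V) \<and>
        killing_equations c1 c2 (fundamental_xypq V)) \<and>
     (\<forall>X. smooth_on coord_domain X \<and> killing_equations c1 c2 X \<longleftrightarrow>
        (\<exists>f g h a b r. \<forall>m \<in> coord_domain.
           X m = f *\<^sub>R fundamental_xypq gen_F m + g *\<^sub>R fundamental_xypq gen_G m
               + h *\<^sub>R fundamental_xypq gen_H m + a *\<^sub>R fundamental_xypq gen_P m
               + b *\<^sub>R fundamental_xypq gen_Q m + r *\<^sub>R fundamental_xypq gen_R m))"
proof -
  note pos = \<open>c1 > 0\<close> \<open>c2 > 0\<close>
  have \<alpha>: "c1 = 4 * \<alpha>" "\<alpha> > 0" and \<gamma>: "c2 = \<gamma>" "\<gamma> > 0" using assms by auto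
  have ds2: "ds2_xypq c1 c2 (x, y, p, q) (dx, dy, dp, dq) = complex_of_real
      (c1 * (dx\<^sup>2 + dy\<^sup>2) / (4 * y\<^sup>2) + c2 / y * ((x\<^sup>2 + y\<^sup>2) * dp\<^sup>2 + dq\<^sup>2 + 2 * x * dp * dq))"
    if "y > 0" for x y p q dx dy dp dq
  proof -
    have "(x, y, p, q) \<in> coord_domain" using that by (simp add: coord_domain_def)
    moreover have "metric_xypq c1 c2 (x, y, p, q) (dx, dy, dp, dq) (dx, dy, dp, dq) =
        c1 * (dx\<^sup>2 + dy\<^sup>2) / (4 * y\<^sup>2) + c2 / y * ((x\<^sup>2 + y\<^sup>2) * dp\<^sup>2 + dq\<^sup>2 + 2 * x * dp * dq)"
      unfolding metric_xypq_eq[OF that] by (simp add: power2_eq_square algebra_simps)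
    ultimately show ?thesis by (simp only: ds2_xypq_eq_metric)
  qed
  have square: "c2 / y * ((x\<^sup>2 + y\<^sup>2) * dp\<^sup>2 + dq\<^sup>2 + 2 * x * dp * dq) =
      c2 * ((x\<^sup>2 + y\<^sup>2) / y) * ((dp + x / (x\<^sup>2 + y\<^sup>2) * dq)\<^sup>2 + (y * dq / (x\<^sup>2 + y\<^sup>2))\<^sup>2)"
    if "y > 0" for x y dp dq :: real
  proof -
    define s where "s = x\<^sup>2 + y\<^sup>2"
    define u where "u = 1 / s"
    have "s > 0" using that by (simp add: s_def add_nonneg_pos)
    then have "s * u = 1" by (simp add: u_def)
    then have "s * dp\<^sup>2 + dq\<^sup>2 + 2 * x * dp * dq = s * ((dp + x * u * dq)\<^sup>2 + (y * dq * u)\<^sup>2)"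
      using s_def by algebra
    then show ?thesis by (simp add: u_def flip: s_def)
  qed
  have line_element: "\<forall>x y p q dx dy dp dq. y > 0 \<longrightarrow>
        ds2_xypq c1 c2 (x, y, p, q) (dx, dy, dp, dq) = complex_of_real
          (c1 * (dx\<^sup>2 + dy\<^sup>2) / (4 * y\<^sup>2)
            + c2 / y * ((x\<^sup>2 + y\<^sup>2) * dp\<^sup>2 + dq\<^sup>2 + 2 * x * dp * dq)) \<and>
        ds2_xypq c1 c2 (x, y, p, q) (dx, dy, dp, dq) = complex_of_real
          (c1 * (dx\<^sup>2 + dy\<^sup>2) / (4 * y\<^sup>2)
            + c2 * ((x\<^sup>2 + y\<^sup>2) / y) *
              ((dp + x / (x\<^sup>2 + y\<^sup>2) * dq)\<^sup>2 + (y * dq / (x\<^sup>2 + y\<^sup>2))\<^sup>2))"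
    by (intro allI impI conjI; simp only: ds2 square)
  have orthonormal: "metric_xypq c1 c2 m (inv_frame \<alpha> \<gamma> \<theta> i m) (inv_frame \<alpha> \<gamma> \<theta> j m) = (if i = j then 1 else 0)"
    if "m \<in> coord_domain" "i \<in> {1, 2, 4, 5}" "j \<in> {1, 2, 4, 5}" for \<theta> m i j
  proof -
    have "metric_xypq c1 c2 m (inv_frame \<alpha> \<gamma> \<theta> i m) (inv_frame \<alpha> \<gamma> \<theta> j m) =
        (\<Sum>k\<in>{1, 2, 4, 5}. (if k = i then 1 else 0) * (if k = j then 1 else 0))"
      unfolding \<alpha>(1) \<gamma>(1) metric_xypq_eq_sum_inv_form[OF \<alpha>(2) \<gamma>(2) that(1), of _ _ \<theta>]
      by (intro sum.cong refl) (simp only: inv_form_inv_frame[OF \<alpha>(2) \<gamma>(2) that(1)] that(2,3))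
    also have "\<dots> = (if i = j then 1 else 0)" using that(2,3) by auto
    finally show ?thesis .
  qed
  have ds2_forms: "ds2_xypq c1 c2 m v = complex_of_real (\<Sum>i\<in>{1, 2, 4, 5}. (inv_form \<alpha> \<gamma> \<theta> i m v)\<^sup>2)"
    if "m \<in> coord_domain" for \<theta> m v
    unfolding ds2_xypq_eq_metric[OF that] power2_eq_square \<alpha>(1) \<gamma>(1)
      metric_xypq_eq_sum_inv_form[OF \<alpha>(2) \<gamma>(2) that, of _ _ \<theta>] ..
  have span: "f *\<^sub>R fundamental_xypq gen_F (x, y, p, q) + g *\<^sub>R fundamental_xypq gen_G (x, y, p, q)
      + h *\<^sub>R fundamental_xypq gen_H (x, y, p, q) + a *\<^sub>R fundamental_xypq gen_P (x, y, p, q)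
      + b *\<^sub>R fundamental_xypq gen_Q (x, y, p, q) + r *\<^sub>R fundamental_xypq gen_R (x, y, p, q) =
    (f + g * (y\<^sup>2 - x\<^sup>2) + 2 * h * x, - 2 * g * x * y + 2 * h * y, - g * q - h * p + a, - f * p + h * q + b)"
    if "y > 0" for f g h a b r x y p q
    unfolding fundamental_xypq_eq[OF that] by simp
  have generators: "smooth_on coord_domain (fundamental_xypq V) \<and> killing_equations c1 c2 (fundamental_xypq V)"
    if "V \<in> {gen_F, gen_G, gen_H, gen_P, gen_Q, gen_R}" for V
  proof -
    note field = jacobi_field_killing_equations[of "fundamental_xypq V" f g h a b for f g h a b]
    show ?thesis
      using that field[of 1 0 0 0 0] field[of 0 1 0 0 0] field[of 0 0 1 0 0] field[of 0 0 0 1 0]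
        field[of 0 0 0 0 1] field[of 0 0 0 0 0]
      by (elim insertE emptyE) (simp_all add: fundamental_xypq_eq)
  qed
  have classification: "smooth_on coord_domain X \<and> killing_equations c1 c2 X \<longleftrightarrow>
        (\<exists>f g h a b r. \<forall>m \<in> coord_domain.
           X m = f *\<^sub>R fundamental_xypq gen_F m + g *\<^sub>R fundamental_xypq gen_G m
               + h *\<^sub>R fundamental_xypq gen_H m + a *\<^sub>R fundamental_xypq gen_P m
               + b *\<^sub>R fundamental_xypq gen_Q m + r *\<^sub>R fundamental_xypq gen_R m)" (is "?L \<longleftrightarrow> ?R") for X
  proof
    assume ?L
    then obtain f g h a b where X: "\<And>x y p q. y > 0 \<Longrightarrow> X (x, y, p, q) =
      (f + g * (y\<^sup>2 - x\<^sup>2) + 2 * h * x, - 2 * g * x * y + 2 * h * y, - g * q - h * p + a, - f * p + h * q + b)"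
      using killing_equations_solution[OF pos] by blast
    have "X m = f *\<^sub>R fundamental_xypq gen_F m + g *\<^sub>R fundamental_xypq gen_G m
        + h *\<^sub>R fundamental_xypq gen_H m + a *\<^sub>R fundamental_xypq gen_P m
        + b *\<^sub>R fundamental_xypq gen_Q m + 0 *\<^sub>R fundamental_xypq gen_R m" if "m \<in> coord_domain" for m
    proof -
      obtain x y p q where "m = (x, y, p, q)" by (metis prod.exhaust)
      moreover from this that have "y > 0" by (simp add: coord_domain_def)
      ultimately show ?thesis by (simp only: X span)
    qed
    then show ?R by blast
  next
    assume ?R
    then obtain f g h a b r where "\<And>m. m \<in> coord_domain \<Longrightarrow>
           X m = f *\<^sub>R fundamental_xypq gen_F m + g *\<^sub>R fundamental_xypq gen_G m
               + h *\<^sub>R fundamental_xypq gen_H m + a *\<^sub>R fundamental_xypq gen_P m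
               + b *\<^sub>R fundamental_xypq gen_Q m + r *\<^sub>R fundamental_xypq gen_R m" by blast
    then have "X (x, y, p, q) =
      (f + g * (y\<^sup>2 - x\<^sup>2) + 2 * h * x, - 2 * g * x * y + 2 * h * y, - g * q - h * p + a, - f * p + h * q + b)"
      if "y > 0" for x y p q
      using that span[OF that] by (simp add: coord_domain_def)
    from jacobi_field_killing_equations[OF this] show ?L by (intro conjI)
  qed
  show ?thesis
  proof (intro conjI, goal_cases)
    case 1 show ?case by (rule line_element)
  next
    case 2 show ?case using ds2_xyxieta_eq by blast
  next
    case 3 show ?case using jacobi_act_preserves_metric by blast
  next
    case 4 show ?case by (rule kaehler_balanced_metric[OF pos])
  next
    case 5 show ?case using metric_matrix_xypq unfolding assms(3,4) by blast
  next
    case 6 show ?case using ds2_forms by blast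
  next
    case 7 show ?case
      by (intro allI ballI conjI inv_form_inv_frame[OF \<alpha>(2) \<gamma>(2)] orthonormal)
  next
    case 8 show ?case by (intro allI impI conjI fundamental_xypq_eq)
  next
    case 9 show ?case by (intro allI impI killing_on_iff_killing_equations[OF pos])
  next
    case 10 show ?case by (intro ballI generators)
  next
    case 11 show ?case by (intro allI classification)
  qed
qed

end
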